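(* Let $X\in\mathbb{P}_m$ and $\mu\in\mathcal{P}^1(\mathbb{P}_m)$. Define $\beta:\mathbb{R}\to\mathbb{P}_m$ by $\beta(t)=G(X\#_t\mu)$. Then $\beta$ is locally Lipschitz continuous on $\mathbb{R}$ and differentiable at $t=0$ with $$\beta'(0)=X^{1/2}\biggl(\int_{\mathbb{P}_m}\log\bigl(X^{-1/2}AX^{-1/2}\bigr)\,d\mu(A)\biggr)X^{1/2}.$$
   Context: $\mathbb{P}_m$ denotes the set of $m\times m$ complex positive definite matrices, with the Riemannian distance $d(A,B)=\|\log(A^{-1/2}BA^{-1/2})\|_2$, where $\|Y\|_2=(\mathrm{tr}\,Y^2)^{1/2}$ for Hermitian $Y$. For $A,B\in\mathbb{P}_m$ and any $t\in\mathbb{R}$, $A\#_tB:=A^{1/2}(A^{-1/2}BA^{-1/2})^tA^{1/2}$. $\mathcal{P}^1(\mathbb{P}_m)$ is the set of Borel probability measures $\mu$ on $\mathbb{P}_m$ with finite first moment, i.e. $\int_{\mathbb{P}_m}d(Z,Y)\,d\mu(Z)<\infty$ for some (equivalently all) $Y\in\mathbb{P}_m$. The Cartan barycenter of $\mu\in\mathcal{P}^1(\mathbb{P}_m)$ is $G(\mu)=\mathrm{arg\,min}_{Z\in\mathbb{P}_m}\int_{\mathbb{P}_m}[d^2(Z,A)-d^2(Y,A)]\,d\mu(A)$ (unique, independent of the fixed $Y\in\mathbb{P}_m$). For $X\in\mathbb{P}_m$, $\mu\in\mathcal{P}^1(\mathbb{P}_m)$ and $t\in\mathbb{R}$, $X\#_t\mu:=(f_t)_*\mu$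 is the push-forward of $\mu$ under the homeomorphism $f_t(A)=X\#_tA$ of $\mathbb{P}_m$ (this lies in $\mathcal{P}^1(\mathbb{P}_m)$). *)

theory Defs
  imports "HOL-Analysis.Analysis" "HOL-Probability.Probability"
begin

definition adjoint_mat :: "complex^'m^'m \<Rightarrow> complex^'m^'m" where
  "adjoint_mat A = (\<chi> i j. cnj (A $ j $ i))"

definition hermitian_mat :: "complex^'m^'m \<Rightarrow> bool" where
  "hermitian_mat A \<longleftrightarrow> adjoint_mat A = A"

definition unitary_mat :: "complex^'m^'m \<Rightarrow> bool" where
  "unitary_mat U \<longleftrightarrow> adjoint_mat U ** U = mat 1"

definition posdef :: "complex^'m^'m \<Rightarrow> bool" where
  "posdef A \<longleftrightarrow> hermitian_mat A \<and>
     (\<forall>x::complex^'m. x \<noteq> 0 \<longrightarrow> Re (\<Sum>i\<in>UNIV. cnj (x $ i) * (A *v x) $ i) > 0)"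

definition diag_mat :: "('m \<Rightarrow> complex) \<Rightarrow> complex^'m^'m" where
  "diag_mat d = (\<chi> i j. if i = j then d i else 0)"

definition trace_mat :: "complex^'m^'m \<Rightarrow> complex" where
  "trace_mat A = (\<Sum>i\<in>UNIV. A $ i $ i)"

text \<open>Functional calculus for Hermitian matrices via spectral decomposition
  A = U diag(d) U^*: f(A) = U diag(f o d) U^* (independent of the decomposition).\<close>
definition mat_fun :: "(real \<Rightarrow> real) \<Rightarrow> complex^'m^'m \<Rightarrow> complex^'m^'m" where
  "mat_fun f A = (SOME B. \<exists>U d. unitary_mat U \<and>
        A = U ** diag_mat (\<lambda>i. complex_of_real (d i)) ** adjoint_mat U \<and>
        B = U ** diag_mat (\<lambda>i. complex_of_real (f (d i))) ** adjoint_mat U)"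

definition pd_pow :: "real \<Rightarrow> complex^'m^'m \<Rightarrow> complex^'m^'m" where
  "pd_pow t A = (if posdef A then mat_fun (\<lambda>x. x powr t) A else 0)"

definition pd_log :: "complex^'m^'m \<Rightarrow> complex^'m^'m" where
  "pd_log A = (if posdef A then mat_fun ln A else 0)"

definition geo :: "real \<Rightarrow> complex^'m^'m \<Rightarrow> complex^'m^'m \<Rightarrow> complex^'m^'m" where
  "geo t A B = (if posdef A \<and> posdef B then
      pd_pow (1/2) A ** pd_pow t (pd_pow (-1/2) A ** B ** pd_pow (-1/2) A) ** pd_pow (1/2) A
    else 0)"

text \<open>Hilbert-Schmidt norm of a Hermitian matrix: (tr Y^2)^(1/2).\<close>
definition hs_norm :: "complex^'m^'m \<Rightarrow> real" where
  "hs_norm Y = sqrt (Re (trace_mat (Y ** Y)))"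

definition riem_dist :: "complex^'m^'m \<Rightarrow> complex^'m^'m \<Rightarrow> real" where
  "riem_dist A B = (if posdef A \<and> posdef B then
      hs_norm (pd_log (pd_pow (-1/2) A ** B ** pd_pow (-1/2) A)) else 0)"

text \<open>Borel probability measures on P_m (realised as Borel probability measures on
  the ambient matrix space concentrated on P_m) with finite first moment.\<close>
definition P1 :: "(complex^'m^'m) measure set" where
  "P1 = {\<mu>. prob_space \<mu> \<and> sets \<mu> = sets borel \<and> (AE A in \<mu>. posdef A) \<and>
            (\<exists>Y. posdef Y \<and> integrable \<mu> (\<lambda>Z. riem_dist Z Y))}"

text \<open>Cartan barycenter: the minimiser over P_m of
  Z \<mapsto> \<integral> d^2(Z,A) - d^2(Y,A) d\<mu>(A), with the reference point Y = I.\<close>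
definition cartan_bary :: "(complex^'m^'m) measure \<Rightarrow> complex^'m^'m" where
  "cartan_bary \<mu> = (THE Z. posdef Z \<and>
     (\<forall>W. posdef W \<longrightarrow>
        (\<integral>A. (riem_dist Z A)\<^sup>2 - (riem_dist (mat 1) A)\<^sup>2 \<partial>\<mu>)
          \<le> (\<integral>A. (riem_dist W A)\<^sup>2 - (riem_dist (mat 1) A)\<^sup>2 \<partial>\<mu>)))"

definition geo_push :: "complex^'m^'m \<Rightarrow> real \<Rightarrow> (complex^'m^'m) measure \<Rightarrow> (complex^'m^'m) measure" where
  "geo_push X t \<mu> = distr \<mu> borel (\<lambda>A. geo t X A)"

end

theory Submission
  imports Defs
begin

text \<open>
  Diagonalise \<open>A = U diag(a) U\<^sup>*\<close>, \<open>B = V diag(b) V\<^sup>*\<close> and put \<open>W = U\<^sup>*V\<close>. Both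
  \<open>\<parallel>log A - log B\<parallel>\<^sup>2\<close> and the congruence invariant \<open>S(A,B) = tr(A\<^sup>-\<^sup>1B) + tr(B\<^sup>-\<^sup>1A) - 2m\<close> are sums over
  \<open>i, j\<close> with weights \<open>\<bar>W i j\<bar>\<^sup>2\<close>, of \<open>x\<^sup>2\<close> and of \<open>(2 sinh (x/2))\<^sup>2\<close> respectively, where
  \<open>x = ln (a i) - ln (b j)\<close>. Hence \<open>\<parallel>log A - log B\<parallel>\<^sup>2 \<le> S(A,B)\<close>, and subdividing the geodesic from
  \<open>A\<close> to \<open>B\<close> turns this into the exponential metric increasing property
  \<open>\<parallel>log A - log B\<parallel> \<le> d(A,B)\<close>. Moving points to the identity by congruence, one deduces from it
  the triangle inequality, the semiparallelogram law and Reshetnyak's quadruple inequality.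

  The semiparallelogram law gives existence and uniqueness of the barycenter together with the variance
  inequality; with the quadruple inequality the latter makes \<open>\<beta>\<close> Lipschitz with constant
  \<open>\<integral> d(X,A) d\<mu>(A)\<close>. For the derivative, write \<open>\<beta>(t) = X\<^sup>1\<^sup>/\<^sup>2 e\<^sup>t\<^sup>K X\<^sup>1\<^sup>/\<^sup>2\<close> and compare
  the value of the objective there with its value at \<open>X\<^sup>1\<^sup>/\<^sup>2 e\<^sup>t\<^sup>H X\<^sup>1\<^sup>/\<^sup>2\<close>, where \<open>H\<close> is the
  mean of the logarithms: after division by \<open>t\<^sup>2\<close> the objective converges to
  \<open>\<parallel>K - H\<parallel>\<^sup>2 - \<parallel>H\<parallel>\<^sup>2\<close>, and it is bounded below by this limit.
\<close>

section \<open>The spectral theorem for Hermitian matrices\<close>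

text \<open>The form is conjugate-linear in its first argument. Its real part is the ambient inner
  product \<open>\<bullet>\<close>, so real compactness arguments apply to complex
  eigenvectors.\<close>

definition hinner :: "complex^'m \<Rightarrow> complex^'m \<Rightarrow> complex" where
  "hinner x y = (\<Sum>i\<in>UNIV. cnj (x $ i) * y $ i)"

lemma Re_hinner: "Re (hinner x y) = x \<bullet> y"
  by (simp add: hinner_def inner_vec_def inner_complex_def)

lemma hinner_self: "hinner x x = of_real ((norm x)\<^sup>2)"
proof -
  have "Im (hinner x x) = 0" by (simp add: hinner_def)
  then show ?thesis
    by (simp add: complex_eq_iff Re_hinner power2_norm_eq_inner)
qed

lemma hinner_add_right: "hinner x (y + z) = hinner x y + hinner x z"
  by (simp add: hinner_def algebra_simps sum.distrib)

lemma hinner_diff_right: "hinner x (y - z) = hinner x y - hinner x z"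
  by (simp add: hinner_def algebra_simps sum_subtractf)

lemma hinner_scaleR_right: "hinner x (c *\<^sub>R y) = of_real c * hinner x y"
  by (simp add: hinner_def sum_distrib_left scaleR_conv_of_real[where 'a=complex] mult_ac)

lemma hinner_scaleR_left: "hinner (c *\<^sub>R x) y = of_real c * hinner x y"
  by (simp add: hinner_def sum_distrib_left scaleR_conv_of_real[where 'a=complex] mult_ac)

lemma hinner_commute: "hinner y x = cnj (hinner x y)"
  by (simp add: hinner_def mult_ac)

lemma hinner_adjoint: "hinner x (A *v y) = hinner (adjoint_mat A *v x) y"
  by (simp add: hinner_def adjoint_mat_def matrix_vector_mult_def sum_distrib_left
      sum_distrib_right mult_ac) (rule sum.swap)

section \<open>Adjoints and unitary matrices\<close>

lemma adjoint_mult: "adjoint_mat (A ** B) = adjoint_mat B ** adjoint_mat A"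
  by (simp add: adjoint_mat_def matrix_matrix_mult_def vec_eq_iff mult_ac)

lemma adjoint_mat_adjoint [simp]: "adjoint_mat (adjoint_mat A) = A"
  by (simp add: adjoint_mat_def vec_eq_iff)

lemma adjoint_one [simp]: "adjoint_mat (mat 1) = mat 1"
  by (auto simp: adjoint_mat_def vec_eq_iff mat_def)

lemma unitary_left: "unitary_mat U \<Longrightarrow> adjoint_mat U ** U = mat 1"
  by (simp add: unitary_mat_def)

lemma unitary_right: "unitary_mat U \<Longrightarrow> U ** adjoint_mat U = mat 1"
  by (simp add: unitary_mat_def matrix_left_right_inverse)

lemma unitary_mat_mult: "unitary_mat U \<Longrightarrow> unitary_mat V \<Longrightarrow> unitary_mat (U ** V)"
  unfolding unitary_mat_def adjoint_mult
  by (metis matrix_mul_assoc matrix_mul_lid)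

lemma unitary_adjoint: "unitary_mat U \<Longrightarrow> unitary_mat (adjoint_mat U)"
  by (metis adjoint_mat_adjoint unitary_mat_def unitary_right)

text \<open>Maximise the quadratic form of \<open>A\<close> over the unit vectors orthogonal to
  \<open>W\<close>. This orthogonal complement is invariant under \<open>A\<close> because
  \<open>W\<close> consists of eigenvectors, and the first variation at a maximiser forces the
  residual \<open>A *v v - l *\<^sub>R v\<close> to vanish.\<close>

lemma hermitian_max_eigenvector:
  fixes A :: "complex^'m^'m" and W :: "(complex^'m) set"
  assumes herm: "hermitian_mat A"
    and x0: "x0 \<noteq> 0" "\<forall>w\<in>W. hinner w x0 = 0"
    and eig: "\<forall>w\<in>W. \<exists>l::real. A *v w = l *\<^sub>R w"
  shows "\<exists>v l. norm v = 1 \<and> (\<forall>w\<in>W. hinner w v = 0) \<and> A *v v = (l::real) *\<^sub>R v"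
proof -
  define V where "V = {x. \<forall>w\<in>W. hinner w x = 0}"
  define q where "q = (\<lambda>x. x \<bullet> (A *v x))"
  have Ac: "hinner x (A *v y) = hinner (A *v x) y" for x y
    using herm hinner_adjoint[of x A y] by (simp add: hermitian_mat_def)
  have Ar: "x \<bullet> (A *v y) = y \<bullet> (A *v x)" for x y
    by (metis Ac Re_hinner inner_commute)
  have Vcl: "closed V"
  proof -
    have "closed {x. hinner w x = 0}" for w :: "complex^'m"
      unfolding hinner_def by (intro closed_Collect_eq continuous_intros)
    then have "closed (\<Inter>w\<in>W. {x. hinner w x = 0})" by blast
    then show ?thesis by (simp add: V_def INTER_eq)
  qed
  have cmp: "compact (V \<inter> sphere 0 1)"
    using Vcl by (simp add: closed_Int_compact)
  have "(1 / norm x0) *\<^sub>R x0 \<in> V \<inter> sphere 0 1"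
    using x0 by (simp add: V_def hinner_scaleR_right)
  then have ne: "V \<inter> sphere 0 1 \<noteq> {}" by blast
  have lin: "bounded_linear (\<lambda>x. A *v x)"
    unfolding linear_conv_bounded_linear[symmetric]
    by (intro linearI) (simp_all add: vec_eq_iff
        matrix_vector_mult_def scaleR_sum_right distrib_left sum.distrib)
  have "continuous_on (V \<inter> sphere 0 1) q"
    unfolding q_def by (intro continuous_intros linear_continuous_on lin)
  then obtain v where v: "v \<in> V \<inter> sphere 0 1" "\<forall>y\<in>V \<inter> sphere 0 1. q y \<le> q v"
    using continuous_attains_sup[OF cmp ne] by blast
  define l where "l = q v"
  have nv: "norm v = 1" using v by simp
  have qscale: "q (c *\<^sub>R y) = c\<^sup>2 * q y" for c y
    by (simp add: q_def linear_scale[OF bounded_linear.linear[OF lin]] power2_eq_square)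
  have qle: "q y \<le> l * (norm y)\<^sup>2" if "y \<in> V" for y
  proof (cases "y = 0")
    case True
    then show ?thesis by (simp add: q_def)
  next
    case False
    then have "(1 / norm y) *\<^sub>R y \<in> V \<inter> sphere 0 1"
      using that by (simp add: V_def hinner_scaleR_right)
    then have "q ((1 / norm y) *\<^sub>R y) \<le> l" using v l_def by blast
    then show ?thesis using False by (simp add: qscale power_divide field_simps)
  qed
  define r where "r = A *v v - l *\<^sub>R v"
  have AV: "A *v x \<in> V" if "x \<in> V" for x
  proof -
    have "hinner w (A *v x) = 0" if w: "w \<in> W" for w
    proof -
      obtain k :: real where "A *v w = k *\<^sub>R w" using eig w by blast
      then show ?thesis using Ac[of w x] \<open>x \<in> V\<close> w by (simp add: hinner_scaleR_left V_def)
    qed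
    then show ?thesis by (simp add: V_def)
  qed
  have rV: "r \<in> V" using AV[of v] v
    by (simp add: r_def V_def hinner_diff_right hinner_scaleR_right)
  \<comment> \<open>Perturb the maximiser in the direction of the residual \<open>r\<close>, which
    lies in \<open>V\<close>: the first-order gain is \<open>2 * t\<close> times the square of the
    norm of \<open>r\<close>, and only second-order terms can balance it.\<close>
  have key: "2 * t * (norm r)\<^sup>2 \<le> t\<^sup>2 * (l * (norm r)\<^sup>2 - q r)" for t
  proof -
    have "v + t *\<^sub>R r \<in> V" using rV v by (simp add: V_def hinner_add_right hinner_scaleR_right)
    then have "q (v + t *\<^sub>R r) \<le> l * (norm (v + t *\<^sub>R r))\<^sup>2" by (rule qle)
    moreover have "q (v + t *\<^sub>R r) = l + 2 * t * (r \<bullet> (A *v v)) + t\<^sup>2 * q r"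
      by (simp add: q_def l_def matrix_vector_right_distrib
          linear_scale[OF bounded_linear.linear[OF lin]]
          Ar[of v r] power2_eq_square algebra_simps)
    moreover have "(norm (v + t *\<^sub>R r))\<^sup>2 = 1 + 2 * t * (r \<bullet> v) + t\<^sup>2 * (norm r)\<^sup>2"
      unfolding power2_norm_eq_inner using nv
      by (simp add: algebra_simps inner_commute norm_eq_1) (simp add: power2_eq_square)
    moreover have "r \<bullet> (A *v v) - l * (r \<bullet> v) = (norm r)\<^sup>2"
      by (simp add: power2_norm_eq_inner r_def inner_diff_right)
    ultimately show ?thesis by (simp add: algebra_simps)
  qed
  have "r = 0"
  proof (rule ccontr)
    assume "r \<noteq> 0"
    \<comment> \<open>The perturbation size \<open>N / C\<close> is small enough for the linear term
      to win; the summand 1 keeps \<open>C\<close> positive.\<close>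
    define N C where "N = (norm r)\<^sup>2" and "C = \<bar>l * (norm r)\<^sup>2 - q r\<bar> + 1"
    have N: "N > 0" and C: "C > 0" using \<open>r \<noteq> 0\<close> by (simp_all add: N_def C_def)
    have "2 * (N / C) * N \<le> (N / C)\<^sup>2 * (l * (norm r)\<^sup>2 - q r)"
      unfolding N_def by (rule key)
    also have "\<dots> \<le> (N / C)\<^sup>2 * C" by (intro mult_left_mono) (auto simp: C_def)
    also have "\<dots> = N * N / C" using C by (simp add: power2_eq_square field_simps)
    finally show False using N C by (simp add: field_simps)
  qed
  then have "A *v v = l *\<^sub>R v" by (simp add: r_def)
  then show ?thesis using nv v V_def by blast
qed

text \<open>Indexing the eigenvectors by a set \<open>S\<close> of coordinates guarantees that there
  are fewer of them than the dimension while a coordinate is missing, so a nonzero vector orthogonal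
  to all of them exists and the induction can proceed.\<close>

lemma hermitian_eigenvectors:
  fixes A :: "complex^'m^'m"
  assumes herm: "hermitian_mat A" and "finite S"
  shows "\<exists>f. (\<forall>i\<in>S. \<forall>j\<in>S. hinner (f i) (f j) = (if i = j then 1 else 0))
    \<and> (\<forall>i\<in>(S::'m set). \<exists>l::real. A *v f i = l *\<^sub>R f i)"
  using \<open>finite S\<close>
proof (induction S rule: finite_induct)
  case empty
  then show ?case by simp
next
  case (insert k S)
  then obtain f where f: "\<forall>i\<in>S. \<forall>j\<in>S. hinner (f i) (f j) = (if i = j then 1 else 0)"
    "\<forall>i\<in>S. \<exists>l::real. A *v f i = l *\<^sub>R f i" by blast
  \<comment> \<open>The rows in \<open>S\<close> are the conjugated eigenvectors and row
    \<open>k\<close> is zero. Hence \<open>M\<close> is singular, and a kernel vector is orthogonal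
    to every \<open>f i\<close>.\<close>
  define M :: "complex^'m^'m" where "M = (\<chi> i j. if i \<in> S then cnj (f i $ j) else 0)"
  have "row k M = 0" using insert by (simp add: row_def M_def vec_eq_iff)
  then have "det M = 0" by (rule det_zero_row)
  then have "\<not> invertible M" by (simp add: invertible_det_nz)
  then obtain x0 where x0: "x0 \<noteq> 0" "M *v x0 = 0"
    by (metis invertible_left_inverse matrix_left_invertible_ker)
  have "hinner (f i) x0 = 0" if "i \<in> S" for i
    using arg_cong[OF x0(2), of "\<lambda>v. v $ i"] that
    by (simp add: M_def matrix_vector_mult_def hinner_def)
  then have "\<exists>v l. norm v = 1 \<and> (\<forall>w\<in>f ` S. hinner w v = 0) \<and> A *v v = (l::real) *\<^sub>R v"
    using f by (intro hermitian_max_eigenvector[OF herm x0(1)]) auto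
  then obtain v l where v: "norm v = 1" "\<forall>w\<in>f ` S. hinner w v = 0" "A *v v = (l::real) *\<^sub>R v"
    by blast
  have "hinner v (f i) = 0" if "i \<in> S" for i
    using v(2) that by (subst hinner_commute) simp
  then show ?case using f v insert
    by (intro exI[of _ "f(k := v)"]) (auto simp: hinner_self[of v])
qed

definition spec :: "complex^'m^'m \<Rightarrow> ('m \<Rightarrow> real) \<Rightarrow> complex^'m^'m" where
  "spec U d = U ** diag_mat (\<lambda>i. complex_of_real (d i)) ** adjoint_mat U"

theorem hermitian_spectral:
  fixes A :: "complex^'m^'m"
  assumes "hermitian_mat A"
  obtains U d where "unitary_mat U" "A = spec U d"
proof -
  obtain f :: "'m \<Rightarrow> complex^'m" and l where f: "\<And>i j. hinner (f i) (f j) = (if i = j then 1 else 0)"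
    "\<And>i. A *v f i = l i *\<^sub>R f i"
    using hermitian_eigenvectors[OF assms finite[of UNIV]] by (metis UNIV_I)
  define U where "U = (\<chi> i j. f j $ i)"
  have U: "unitary_mat U"
    unfolding unitary_mat_def using f(1)
    by (simp add: U_def matrix_matrix_mult_def adjoint_mat_def hinner_def vec_eq_iff mat_def)
  have "A ** U = U ** diag_mat (\<lambda>i. complex_of_real (l i))"
  proof -
    have "(A ** U) $ i $ j = (A *v f j) $ i" for i j
      by (simp add: U_def matrix_matrix_mult_def matrix_vector_mult_def)
    moreover have "(U ** diag_mat (\<lambda>i. complex_of_real (l i))) $ i $ j = of_real (l j) * f j $ i" for i j
      by (simp add: U_def matrix_matrix_mult_def diag_mat_def if_distrib cong: if_cong)
    ultimately show ?thesis
      by (simp add: vec_eq_iff f(2) scaleR_conv_of_real[where 'a=complex])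
  qed
  then have "A = spec U l"
    unfolding spec_def by (metis U matrix_mul_assoc matrix_mul_rid unitary_right)
  with U that show ?thesis by blast
qed

section \<open>Spectral calculus\<close>

lemma bounded_bilinear_matmul: "bounded_bilinear ((**) :: complex^'m^'m \<Rightarrow> complex^'m^'m \<Rightarrow> complex^'m^'m)"
proof -
  have "bilinear ((**) :: complex^'m^'m \<Rightarrow> complex^'m^'m \<Rightarrow> complex^'m^'m)"
    unfolding bilinear_def
    by (intro allI conjI linearI)
      (simp_all add: matrix_matrix_mult_def vec_eq_iff distrib_left distrib_right sum.distrib scaleR_sum_right)
  then show ?thesis by (simp add: bilinear_conv_bounded_bilinear)
qed

interpretation matmul: bounded_bilinear "(**) :: complex^'m^'m \<Rightarrow> complex^'m^'m \<Rightarrow> complex^'m^'m"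
  by (rule bounded_bilinear_matmul)

lemma diag_mat_matmul: "(diag_mat d ** B) $ i $ j = d i * B $ i $ j"
proof -
  have "(diag_mat d ** B) $ i $ j = (\<Sum>k\<in>UNIV. if i = k then d i * B $ k $ j else 0)"
    unfolding diag_mat_def matrix_matrix_mult_def by (simp only: vec_lambda_beta, intro sum.cong) auto
  then show ?thesis by simp
qed

lemma matmul_diag_mat: "(B ** diag_mat d) $ i $ j = B $ i $ j * d j"
proof -
  have "(B ** diag_mat d) $ i $ j = (\<Sum>k\<in>UNIV. if j = k then B $ i $ k * d k else 0)"
    unfolding diag_mat_def matrix_matrix_mult_def by (simp only: vec_lambda_beta, intro sum.cong) auto
  then show ?thesis by simp
qed

lemma diag_mat_mult: "diag_mat d ** diag_mat e = diag_mat (\<lambda>i. d i * e i)"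
  unfolding vec_eq_iff diag_mat_matmul by (simp add: diag_mat_def)

lemma diag_mat_vec: "(diag_mat d *v x) $ i = d i * x $ i"
proof -
  have "(diag_mat d *v x) $ i = (\<Sum>k\<in>UNIV. if i = k then d i * x $ k else 0)"
    unfolding diag_mat_def matrix_vector_mult_def by (simp only: vec_lambda_beta, intro sum.cong) auto
  then show ?thesis by simp
qed

lemma adjoint_diag_of_real [simp]:
  "adjoint_mat (diag_mat (\<lambda>i. complex_of_real (d i))) = diag_mat (\<lambda>i. complex_of_real (d i))"
  by (auto simp: adjoint_mat_def diag_mat_def vec_eq_iff)

lemma adjoint_spec [simp]: "adjoint_mat (spec U d) = spec U d"
  by (simp add: spec_def adjoint_mult matrix_mul_assoc)

lemma hermitian_spec [simp]: "hermitian_mat (spec U d)"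
  by (simp add: hermitian_mat_def)

lemma spec_mult:
  assumes "unitary_mat U"
  shows "spec U d ** spec U e = spec U (\<lambda>i. d i * e i)"
proof -
  let ?D = "\<lambda>d. diag_mat (\<lambda>i. complex_of_real (d i))"
  have "spec U d ** spec U e = U ** ?D d ** (adjoint_mat U ** U) ** ?D e ** adjoint_mat U"
    by (simp add: spec_def matrix_mul_assoc)
  also have "\<dots> = U ** (?D d ** ?D e) ** adjoint_mat U"
    by (simp add: unitary_left[OF assms] matrix_mul_assoc)
  finally show ?thesis by (simp add: diag_mat_mult spec_def)
qed

lemma spec_one: "unitary_mat U \<Longrightarrow> spec U (\<lambda>_. 1) = mat 1"
  for U :: "complex^'m^'m"
proof -
  have "diag_mat (\<lambda>_::'m. complex_of_real 1) = mat 1"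
    by (auto simp: diag_mat_def mat_def vec_eq_iff)
  then show "unitary_mat U \<Longrightarrow> spec U (\<lambda>_. 1) = mat 1"
    by (simp add: spec_def unitary_right)
qed

lemma unitary_one [simp]: "unitary_mat (mat 1)"
  by (simp add: unitary_mat_def)

text \<open>Identifies the Euclidean inner product of the vector type with the Hilbert-Schmidt one;
  unitary invariance of \<open>norm\<close> then becomes a matter of traces.\<close>

lemma inner_eq_trace: "A \<bullet> B = Re (trace (adjoint_mat A ** B))"
  for A B :: "complex^'m^'m"
proof -
  have "A \<bullet> B = (\<Sum>i\<in>UNIV. \<Sum>j\<in>UNIV. Re (cnj (A $ i $ j) * B $ i $ j))"
    by (simp add: inner_vec_def inner_complex_def)
  also have "\<dots> = (\<Sum>j\<in>UNIV. \<Sum>i\<in>UNIV. Re (cnj (A $ i $ j) * B $ i $ j))"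
    by (rule sum.swap)
  finally show ?thesis
    by (simp add: trace_def adjoint_mat_def matrix_matrix_mult_def)
qed

section \<open>Unitary invariance of the norm and the overlap of two eigenbases\<close>

lemma norm_unitary_left: "unitary_mat U \<Longrightarrow> norm (U ** A) = norm A"
  for A U :: "complex^'m^'m"
proof -
  assume U: "unitary_mat U"
  have "adjoint_mat (U ** A) ** (U ** A) = adjoint_mat A ** (adjoint_mat U ** U) ** A"
    by (simp add: adjoint_mult matrix_mul_assoc)
  then show ?thesis by (simp add: norm_eq_sqrt_inner inner_eq_trace unitary_left[OF U])
qed

lemma norm_unitary_right: "unitary_mat U \<Longrightarrow> norm (A ** U) = norm A"
  for A U :: "complex^'m^'m"
proof -
  assume U: "unitary_mat U"
  have "trace (adjoint_mat (A ** U) ** (A ** U)) = trace ((A ** U) ** adjoint_mat (A ** U))"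
    by (rule trace_mul_sym)
  also have "(A ** U) ** adjoint_mat (A ** U) = A ** (U ** adjoint_mat U) ** adjoint_mat A"
    by (simp add: adjoint_mult matrix_mul_assoc)
  also have "trace \<dots> = trace (adjoint_mat A ** A)"
    by (simp add: unitary_right[OF U] trace_mul_sym[of A])
  finally show ?thesis by (simp add: norm_eq_sqrt_inner inner_eq_trace)
qed

lemma hs_norm_eq_norm: "hermitian_mat A \<Longrightarrow> hs_norm A = norm A"
  by (simp add: hs_norm_def norm_eq_sqrt_inner inner_eq_trace hermitian_mat_def trace_mat_def trace_def)

text \<open>Squared moduli of the overlaps between the two eigenbases. For unitary \<open>U\<close>
  and \<open>V\<close> they form a doubly stochastic matrix.\<close>

definition transition :: "complex^'m^'m \<Rightarrow> complex^'m^'m \<Rightarrow> 'm \<Rightarrow> 'm \<Rightarrow> real" where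
  "transition U V i j = (cmod ((adjoint_mat U ** V) $ i $ j))\<^sup>2"

lemma transition_nonneg [simp]: "0 \<le> transition U V i j"
  by (simp add: transition_def)

lemma norm_mat_power2: "(norm A)\<^sup>2 = (\<Sum>i\<in>UNIV. \<Sum>j\<in>UNIV. (cmod (A $ i $ j))\<^sup>2)"
  for A :: "complex^'m^'m"
  by (simp add: norm_vec_def L2_set_def sum_nonneg)

text \<open>Multiplying by the adjoint of \<open>U\<close> on the left and by \<open>V\<close> on
  the right preserves the norm and leaves the matrix with entries
  \<open>(d i - e j) * W i j\<close>, where \<open>W\<close> is the overlap matrix.\<close>

lemma norm_spec_diff:
  fixes U V :: "complex^'m^'m"
  assumes U: "unitary_mat U" and V: "unitary_mat V"
  shows "(norm (spec U d - spec V e))\<^sup>2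
    = (\<Sum>i\<in>UNIV. \<Sum>j\<in>UNIV. transition U V i j * (d i - e j)\<^sup>2)"
proof -
  let ?D = "\<lambda>d. diag_mat (\<lambda>i. complex_of_real (d i))"
  let ?W = "adjoint_mat U ** V"
  have "adjoint_mat U ** (spec U d - spec V e) ** V
    = (adjoint_mat U ** U) ** ?D d ** ?W - ?W ** ?D e ** (adjoint_mat V ** V)"
    by (simp add: spec_def matrix_mul_assoc matmul.diff_left matmul.diff_right)
  also have "\<dots> = ?D d ** ?W - ?W ** ?D e"
    by (simp add: unitary_left U V)
  finally have eq: "adjoint_mat U ** (spec U d - spec V e) ** V = ?D d ** ?W - ?W ** ?D e" .
  have ent: "(?D d ** ?W - ?W ** ?D e) $ i $ j = of_real (d i - e j) * ?W $ i $ j" for i j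
    by (simp add: diag_mat_matmul matmul_diag_mat left_diff_distrib)
  have "norm (spec U d - spec V e) = norm (?D d ** ?W - ?W ** ?D e)"
    unfolding eq[symmetric]
    by (simp add: norm_unitary_left norm_unitary_right unitary_adjoint U V)
  then show ?thesis
    by (simp only: norm_mat_power2 ent norm_mult norm_of_real power_mult_distrib power2_abs
        transition_def mult.commute)
qed

lemma transition_row_sum:
  assumes U: "unitary_mat U" and V: "unitary_mat V"
  shows "(\<Sum>j\<in>UNIV. transition U V i j) = 1"
proof -
  let ?W = "adjoint_mat U ** V"
  have "unitary_mat ?W" by (simp add: U V unitary_adjoint unitary_mat_mult)
  then have "(?W ** adjoint_mat ?W) $ i $ i = 1"
    by (simp add: unitary_right mat_def)
  then have "(\<Sum>j\<in>UNIV. ?W $ i $ j * cnj (?W $ i $ j)) = 1"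
    by (simp add: matrix_matrix_mult_def[of ?W] adjoint_mat_def[of ?W])
  then have "complex_of_real (\<Sum>j\<in>UNIV. transition U V i j) = 1"
    by (simp only: transition_def complex_norm_square of_real_sum)
  then show ?thesis using of_real_eq_1_iff by blast
qed

lemma transition_commute: "transition U V i j = transition V U j i"
proof -
  have "(adjoint_mat U ** V) = adjoint_mat (adjoint_mat V ** U)"
    by (simp add: adjoint_mult)
  then have "(adjoint_mat U ** V) $ i $ j = cnj ((adjoint_mat V ** U) $ j $ i)"
    by (simp add: adjoint_mat_def[of "adjoint_mat V ** U"])
  then show ?thesis by (simp add: transition_def)
qed

lemma transition_col_sum:
  assumes "unitary_mat U" "unitary_mat V"
  shows "(\<Sum>i\<in>UNIV. transition U V i j) = 1"
  using transition_row_sum[OF assms(2,1)] by (simp add: transition_commute[of U V])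

lemma transition_self: "unitary_mat U \<Longrightarrow> transition U U i j = (if i = j then 1 else 0)"
  by (simp add: transition_def unitary_left mat_def)

lemma norm_spec: "unitary_mat U \<Longrightarrow> (norm (spec U d))\<^sup>2 = (\<Sum>i\<in>UNIV. (d i)\<^sup>2)"
proof -
  have z: "spec U (\<lambda>_. 0) = 0"
    by (simp add: spec_def diag_mat_def matrix_matrix_mult_def zero_vec_def vec_eq_iff)
  show "unitary_mat U \<Longrightarrow> (norm (spec U d))\<^sup>2 = (\<Sum>i\<in>UNIV. (d i)\<^sup>2)"
    using norm_spec_diff[of U U d "\<lambda>_. 0"]
    by (simp add: z transition_self if_distrib if_distribR cong: if_cong)
qed

text \<open>Polarisation of \<open>norm_spec_diff\<close>: the pure squares collapse because rows
  and columns of the weights sum to 1.\<close>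

lemma inner_spec:
  fixes U V :: "complex^'m^'m"
  assumes U: "unitary_mat U" and V: "unitary_mat V"
  shows "spec U d \<bullet> spec V e = (\<Sum>i\<in>UNIV. \<Sum>j\<in>UNIV. transition U V i j * (d i * e j))"
proof -
  let ?s = "\<lambda>f. \<Sum>i\<in>UNIV. \<Sum>j\<in>UNIV. transition U V i j * f i j"
  have 1: "?s (\<lambda>i j. (d i)\<^sup>2) = (norm (spec U d))\<^sup>2"
    by (simp add: norm_spec[OF U] sum_distrib_right[symmetric] transition_row_sum[OF U V])
  have 2: "?s (\<lambda>i j. (e j)\<^sup>2) = (norm (spec V e))\<^sup>2"
    by (subst sum.swap)
      (simp add: norm_spec[OF V] sum_distrib_right[symmetric] transition_col_sum[OF U V])
  have "?s (\<lambda>i j. (d i - e j)\<^sup>2) = ?s (\<lambda>i j. (d i)\<^sup>2) + ?s (\<lambda>i j. (e j)\<^sup>2) - 2 * ?s (\<lambda>i j. d i * e j)"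
    by (simp add: sum_distrib_left flip: sum.distrib sum_subtractf)
      (simp add: power2_eq_square algebra_simps)
  then show ?thesis
    unfolding 1 2 norm_spec_diff[OF U V, symmetric]
    by (simp add: power2_norm_eq_inner inner_diff inner_commute)
qed

text \<open>Equality of the two matrices forces every weight between distinct eigenvalues to be
  zero, and these are the only pairs at which \<open>f\<close> could make a difference. The
  functional calculus is thus independent of the diagonalisation, which resolves the choice in
  \<open>mat_fun\<close>.\<close>

lemma spec_comp_cong:
  assumes U: "unitary_mat U" and V: "unitary_mat V" and eq: "spec U d = spec V e"
  shows "spec U (\<lambda>i. f (d i)) = spec V (\<lambda>i. f (e i))"
proof -
  have "(\<Sum>i\<in>UNIV. \<Sum>j\<in>UNIV. transition U V i j * (d i - e j)\<^sup>2) = 0"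
    using norm_spec_diff[OF U V, of d e] eq by simp
  then have "transition U V i j * (d i - e j)\<^sup>2 = 0" for i j
    by (simp add: sum_nonneg_eq_0_iff sum_nonneg)
  then have *: "transition U V i j * (f (d i) - f (e j))\<^sup>2 = 0" for i j
    by (cases "d i = e j") auto
  then have "(norm (spec U (\<lambda>i. f (d i)) - spec V (\<lambda>i. f (e i))))\<^sup>2 = 0"
    unfolding norm_spec_diff[OF U V] by (intro sum.neutral ballI *)
  then show ?thesis by simp
qed

lemma mat_fun_spec:
  assumes U: "unitary_mat U"
  shows "mat_fun f (spec U d) = spec U (\<lambda>i. f (d i))"
proof -
  have "\<exists>V e. unitary_mat V \<and> spec U d = spec V e \<and> mat_fun f (spec U d) = spec V (\<lambda>i. f (e i))"
    unfolding mat_fun_def spec_def[symmetric]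
    by (rule someI_ex) (use U in blast)
  then show ?thesis using spec_comp_cong[OF U] by metis
qed

section \<open>Positive definiteness in terms of eigenvalues\<close>

lemma inner_spec_vec: "x \<bullet> (spec U d *v x) = (\<Sum>i\<in>UNIV. d i * (cmod ((adjoint_mat U *v x) $ i))\<^sup>2)"
proof -
  let ?y = "adjoint_mat U *v x"
  have "hinner x (spec U d *v x) = hinner ?y (diag_mat (\<lambda>i. complex_of_real (d i)) *v ?y)"
    by (simp add: spec_def hinner_adjoint matrix_vector_mul_assoc[symmetric])
  also have "\<dots> = (\<Sum>i\<in>UNIV. of_real (d i) * (?y $ i * cnj (?y $ i)))"
    by (simp add: hinner_def diag_mat_vec mult_ac)
  also have "\<dots> = of_real (\<Sum>i\<in>UNIV. d i * (cmod (?y $ i))\<^sup>2)"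
    by (simp only: complex_norm_square[symmetric] of_real_sum of_real_mult of_real_power)
  finally show ?thesis by (metis Re_complex_of_real Re_hinner)
qed

lemma posdef_iff: "posdef A \<longleftrightarrow> hermitian_mat A \<and> (\<forall>x. x \<noteq> 0 \<longrightarrow> x \<bullet> (A *v x) > 0)"
  by (simp only: posdef_def Re_hinner[symmetric] hinner_def)

lemma posdef_spec:
  assumes U: "unitary_mat U"
  shows "posdef (spec U d) \<longleftrightarrow> (\<forall>i. 0 < d i)"
proof
  assume pd: "posdef (spec U d)"
  show "\<forall>i. 0 < d i"
  proof
    fix i
    define x where "x = U *v axis i 1"
    have y: "adjoint_mat U *v x = axis i 1"
      by (simp add: x_def matrix_vector_mul_assoc unitary_left[OF U])
    then have "x \<noteq> 0" by (metis axis_eq_0_iff matrix_vector_mult_0_right zero_neq_one)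
    then have "0 < x \<bullet> (spec U d *v x)" using pd by (simp add: posdef_iff)
    also have "\<dots> = d i"
      by (simp add: inner_spec_vec y axis_def if_distrib if_distribR cong: if_cong)
    finally show "0 < d i" .
  qed
next
  assume d: "\<forall>i. 0 < d i"
  have "x \<bullet> (spec U d *v x) > 0" if "x \<noteq> 0" for x
  proof -
    have "adjoint_mat U *v x \<noteq> 0"
      using that by (metis matrix_vector_mul_assoc matrix_vector_mul_lid matrix_vector_mult_0_right
          unitary_right[OF U])
    then obtain i where i: "(adjoint_mat U *v x) $ i \<noteq> 0" by (auto simp: vec_eq_iff)
    show ?thesis unfolding inner_spec_vec
      using d i by (intro sum_pos2[of _ i]) (auto intro!: mult_nonneg_nonneg intro: less_imp_le)
  qed
  then show "posdef (spec U d)" by (simp add: posdef_iff)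
qed

lemma posdef_spectral:
  assumes "posdef A"
  obtains U h where "unitary_mat U" "A = spec U (\<lambda>i. exp (h i))"
proof -
  have "hermitian_mat A" using assms posdef_iff by blast
  then obtain U d where U: "unitary_mat U" "A = spec U d" by (rule hermitian_spectral)
  then have "\<forall>i. 0 < d i" using assms posdef_spec by blast
  then have "A = spec U (\<lambda>i. exp (ln (d i)))" using U by simp
  with U(1) show ?thesis by (rule that)
qed

section \<open>Exponential, logarithm and congruence\<close>

text \<open>Off the Hermitian matrices the choice in \<open>mat_fun\<close> is unconstrained, so the
  facts about \<open>mexp\<close> concern Hermitian arguments.\<close>

definition mexp :: "complex^'m^'m \<Rightarrow> complex^'m^'m" where
  "mexp = mat_fun exp"

lemma hermitian_scaleR [simp]: "hermitian_mat A \<Longrightarrow> hermitian_mat (c *\<^sub>R A)"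
  by (simp add: hermitian_mat_def adjoint_mat_def vec_eq_iff)

lemma hermitian_uminus [simp]: "hermitian_mat A \<Longrightarrow> hermitian_mat (- A)"
  by (simp add: hermitian_mat_def adjoint_mat_def vec_eq_iff)

lemma hermitian_zero [simp]: "hermitian_mat 0"
  by (simp add: hermitian_mat_def adjoint_mat_def vec_eq_iff)

lemma scaleR_spec: "c *\<^sub>R spec U d = spec U (\<lambda>i. c * d i)"
proof -
  have "diag_mat (\<lambda>i. complex_of_real (c * d i)) = c *\<^sub>R diag_mat (\<lambda>i. complex_of_real (d i))"
    by (simp add: diag_mat_def vec_eq_iff scaleR_conv_of_real[where 'a=complex])
  then show ?thesis by (simp add: spec_def matmul.scaleR_left matmul.scaleR_right)
qed

lemma mexp_spec: "unitary_mat U \<Longrightarrow> mexp (spec U h) = spec U (\<lambda>i. exp (h i))"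
  by (simp add: mexp_def mat_fun_spec)

lemma posdef_mexp [simp]: "hermitian_mat H \<Longrightarrow> posdef (mexp H)"
  by (elim hermitian_spectral) (simp add: mexp_spec posdef_spec)

lemma posdef_hermitian: "posdef A \<Longrightarrow> hermitian_mat A"
  by (simp add: posdef_def)

lemma pd_log_mexp [simp]: "hermitian_mat H \<Longrightarrow> pd_log (mexp H) = H"
  by (elim hermitian_spectral) (simp add: mexp_spec posdef_spec pd_log_def mat_fun_spec)

lemma posdef_obtain_mexp:
  assumes "posdef A" obtains H where "hermitian_mat H" "A = mexp H"
  using assms by (metis hermitian_spec mexp_spec posdef_spectral)

lemma mexp_pd_log [simp]: "posdef A \<Longrightarrow> mexp (pd_log A) = A"
  by (elim posdef_obtain_mexp) simp

lemma hermitian_pd_log [simp]: "hermitian_mat (pd_log A)"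
proof (cases "posdef A")
  case True
  then show ?thesis by (elim posdef_obtain_mexp) simp
qed (simp add: pd_log_def)

lemma mexp_zero [simp]: "mexp 0 = (mat 1 :: complex^'m^'m)"
proof -
  have "(0::complex^'m^'m) = 0 *\<^sub>R spec (mat 1) (\<lambda>_. 1)" by simp
  also have "mexp \<dots> = mat 1"
    unfolding scaleR_spec by (simp add: mexp_spec spec_one)
  finally show ?thesis .
qed

lemma posdef_one [simp]: "posdef (mat 1)"
  by (metis hermitian_zero mexp_zero posdef_mexp)

lemma pd_log_one [simp]: "pd_log (mat 1) = 0"
  by (metis hermitian_zero mexp_zero pd_log_mexp)

section \<open>One-parameter groups and real powers\<close>

lemma mexp_add_scaleR:
  "hermitian_mat H \<Longrightarrow> mexp (s *\<^sub>R H) ** mexp (t *\<^sub>R H) = mexp ((s + t) *\<^sub>R H)"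
  by (elim hermitian_spectral)
    (simp add: scaleR_spec mexp_spec spec_mult distrib_right exp_add)

lemma mexp_mult_minus: "hermitian_mat H \<Longrightarrow> mexp H ** mexp (- H) = mat 1"
  using mexp_add_scaleR[of H 1 "-1"] by simp

lemma pd_pow_mexp: "hermitian_mat H \<Longrightarrow> pd_pow t (mexp H) = mexp (t *\<^sub>R H)"
  unfolding pd_pow_def
  by (elim hermitian_spectral) (simp add: scaleR_spec mexp_spec posdef_spec mat_fun_spec powr_def)

lemma pd_pow_eq_mexp: "posdef A \<Longrightarrow> pd_pow t A = mexp (t *\<^sub>R pd_log A)"
  by (metis hermitian_pd_log mexp_pd_log pd_pow_mexp)

lemma posdef_pd_pow [simp]: "posdef A \<Longrightarrow> posdef (pd_pow t A)"
  by (simp add: pd_pow_eq_mexp)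

lemma pd_pow_mult: "posdef A \<Longrightarrow> pd_pow s A ** pd_pow t A = pd_pow (s + t) A"
  by (simp add: pd_pow_eq_mexp mexp_add_scaleR)

lemma pd_pow_zero [simp]: "posdef A \<Longrightarrow> pd_pow 0 A = mat 1"
  by (simp add: pd_pow_eq_mexp)

lemma pd_pow_one [simp]: "posdef A \<Longrightarrow> pd_pow 1 A = A"
  by (simp add: pd_pow_eq_mexp)

lemma adjoint_pd_pow [simp]: "posdef A \<Longrightarrow> adjoint_mat (pd_pow t A) = pd_pow t A"
  using posdef_hermitian[OF posdef_pd_pow[of A t]] by (simp add: hermitian_mat_def)

lemma adjoint_mexp [simp]: "hermitian_mat H \<Longrightarrow> adjoint_mat (mexp H) = mexp H"
  using posdef_hermitian[OF posdef_mexp[of H]] by (simp add: hermitian_mat_def)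

text \<open>Conjugation replaces the eigenbasis \<open>V\<close> by \<open>U ** V\<close> and keeps
  the eigenvalues, on which alone the norm of the logarithm depends.\<close>

lemma pd_log_unitary_conj:
  assumes U: "unitary_mat U" and A: "posdef A"
  shows "posdef (U ** A ** adjoint_mat U)"
    and "norm (pd_log (U ** A ** adjoint_mat U)) = norm (pd_log A)"
proof -
  obtain V h where V: "unitary_mat V" "A = spec V (\<lambda>i. exp (h i))"
    using posdef_spectral[OF A] by blast
  have UV: "unitary_mat (U ** V)" using U V unitary_mat_mult by blast
  have eq: "U ** A ** adjoint_mat U = mexp (spec (U ** V) h)"
    unfolding mexp_spec[OF UV] by (simp add: V spec_def adjoint_mult matrix_mul_assoc)
  show "posdef (U ** A ** adjoint_mat U)" by (simp add: eq)
  have "pd_log A = spec V h"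
    using V by (simp flip: mexp_spec)
  then have "(norm (pd_log (U ** A ** adjoint_mat U)))\<^sup>2 = (norm (pd_log A))\<^sup>2"
    unfolding eq by (simp add: norm_spec V(1) UV)
  then show "norm (pd_log (U ** A ** adjoint_mat U)) = norm (pd_log A)"
    by (simp add: power2_eq_iff_nonneg)
qed

text \<open>The action of invertible matrices on the positive definite cone; it preserves both
  \<open>riem_dist\<close> and \<open>sdiv\<close>, so any point can be moved to the
  identity.\<close>

definition congr :: "complex^'m^'m \<Rightarrow> complex^'m^'m \<Rightarrow> complex^'m^'m" where
  "congr C A = C ** A ** adjoint_mat C"

lemma congr_congr: "congr C (congr D A) = congr (C ** D) A"
  by (simp add: congr_def adjoint_mult matrix_mul_assoc)

lemma congr_one [simp]: "congr (mat 1) A = A"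
  by (simp add: congr_def)

lemma invertible_adjoint:
  assumes "invertible C" shows "invertible (adjoint_mat C)"
proof -
  obtain D where "C ** D = mat 1" using assms invertible_def by blast
  then have "adjoint_mat D ** adjoint_mat C = mat 1" by (metis adjoint_mult adjoint_one)
  then show ?thesis using invertible_left_inverse by blast
qed

lemma posdef_congr:
  assumes C: "invertible C" and A: "posdef A"
  shows "posdef (congr C A)"
proof -
  have "hermitian_mat (congr C A)"
    using posdef_hermitian[OF A]
    by (simp add: hermitian_mat_def congr_def adjoint_mult matrix_mul_assoc)
  moreover have "x \<bullet> (congr C A *v x) > 0" if "x \<noteq> 0" for x
  proof -
    obtain D where "D ** adjoint_mat C = mat 1"
      using invertible_adjoint[OF C] invertible_def by blast
    then have "adjoint_mat C *v x \<noteq> 0"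
      using that by (metis matrix_vector_mul_assoc matrix_vector_mul_lid matrix_vector_mult_0_right)
    then have "0 < (adjoint_mat C *v x) \<bullet> (A *v (adjoint_mat C *v x))"
      using A posdef_iff by blast
    also have "\<dots> = x \<bullet> (congr C A *v x)"
      by (simp add: Re_hinner[symmetric] congr_def hinner_adjoint[of x C] flip: matrix_vector_mul_assoc)
    finally show ?thesis .
  qed
  ultimately show ?thesis by (simp add: posdef_iff)
qed

lemma invertible_pd_pow [simp]: "posdef A \<Longrightarrow> invertible (pd_pow t A)"
  unfolding invertible_right_inverse
  by (rule exI[of _ "pd_pow (-t) A"]) (simp add: pd_pow_mult)

lemma invertible_mexp [simp]: "hermitian_mat H \<Longrightarrow> invertible (mexp H)"
  unfolding invertible_right_inverse using mexp_mult_minus by blast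

lemma congr_pd_pow: "posdef A \<Longrightarrow> congr (pd_pow s A) (pd_pow t A) = pd_pow (2 * s + t) A"
  by (simp add: congr_def pd_pow_mult algebra_simps)

lemma congr_mexp: "hermitian_mat H \<Longrightarrow> congr (mexp (s *\<^sub>R H)) (mexp (t *\<^sub>R H)) = mexp ((2 * s + t) *\<^sub>R H)"
  unfolding congr_def by (simp add: mexp_add_scaleR)

lemma posdef_normalize [simp]: "posdef X \<Longrightarrow> posdef A \<Longrightarrow> posdef (congr (pd_pow t X) A)"
  by (simp add: posdef_congr)

lemma riem_dist_eq:
  "posdef A \<Longrightarrow> posdef B \<Longrightarrow> riem_dist A B = norm (pd_log (congr (pd_pow (-1/2) A) B))"
  by (simp add: riem_dist_def hs_norm_eq_norm congr_def)

lemma riem_dist_nonneg [simp]: "0 \<le> riem_dist A B"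
  unfolding riem_dist_def by (auto simp: hs_norm_eq_norm)

lemma riem_dist_one: "posdef B \<Longrightarrow> riem_dist (mat 1) B = norm (pd_log B)"
  by (simp add: riem_dist_eq pd_pow_eq_mexp)

text \<open>The polar part of \<open>C A\<^sup>1\<^sup>/\<^sup>2\<close> with respect to \<open>C A C\<^sup>*\<close> is unitary, and it conjugates the two
  normalised matrices.\<close>

lemma riem_dist_congr:
  assumes C: "invertible C" and A: "posdef A" and B: "posdef B"
  shows "riem_dist (congr C A) (congr C B) = riem_dist A B"
proof -
  define E where "E = congr C A"
  have E: "posdef E" unfolding E_def by (rule posdef_congr[OF C A])
  define U where "U = pd_pow (-1/2) E ** C ** pd_pow (1/2) A"
  have "U ** adjoint_mat U = congr (pd_pow (-1/2) E) (C ** (pd_pow (1/2) A ** pd_pow (1/2) A) ** adjoint_mat C)"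
    using A E by (simp add: U_def adjoint_mult congr_def matrix_mul_assoc)
  also have "\<dots> = congr (pd_pow (-1/2) E) (pd_pow 1 E)"
    using A E by (simp add: pd_pow_mult E_def congr_def)
  also have "\<dots> = mat 1" unfolding congr_pd_pow[OF E] using E by simp
  finally have "U ** adjoint_mat U = mat 1" .
  then have U: "unitary_mat U" unfolding unitary_mat_def using matrix_left_right_inverse by blast
  have "U ** pd_pow (-1/2) A = pd_pow (-1/2) E ** C ** (pd_pow (1/2) A ** pd_pow (-1/2) A)"
    by (simp add: U_def matrix_mul_assoc)
  then have "U ** pd_pow (-1/2) A = pd_pow (-1/2) E ** C" using A by (simp add: pd_pow_mult)
  then have "congr (pd_pow (-1/2) E) (congr C B) = congr U (congr (pd_pow (-1/2) A) B)"
    by (simp add: congr_congr)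
  then show ?thesis
    using pd_log_unitary_conj(2)[OF U, of "congr (pd_pow (-1/2) A) B"] A B C E
    by (simp add: riem_dist_eq posdef_congr flip: E_def congr_def)
qed

lemma congr_pd_pow_inverse: "posdef X \<Longrightarrow> congr (pd_pow t X) (congr (pd_pow (-t) X) A) = A"
  by (simp add: congr_congr pd_pow_mult)

text \<open>A geodesic from \<open>A\<close> to \<open>B\<close> is, up to congruence, \<open>t \<mapsto> e\<^sup>t\<^sup>Q\<close>; the parameter \<open>s\<close> chooses the
  point that is moved to the identity.\<close>

lemma geodesic_normal_form:
  assumes A: "posdef A" and B: "posdef B"
  obtains C Q where "invertible C" "hermitian_mat Q"
    "A = congr C (mexp ((-s) *\<^sub>R Q))" "B = congr C (mexp ((1 - s) *\<^sub>R Q))"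
proof -
  define Q where "Q = pd_log (congr (pd_pow (-1/2) A) B)"
  have Q: "hermitian_mat Q" by (simp add: Q_def)
  have mQ: "mexp Q = congr (pd_pow (-1/2) A) B" using A B by (simp add: Q_def)
  \<comment> \<open>A congruence applies its factor on both sides, so the exponent
    \<open>s/2\<close> shifts the parameter along the geodesic by \<open>s\<close>.\<close>
  define C where "C = pd_pow (1/2) A ** mexp ((s/2) *\<^sub>R Q)"
  have C: "invertible C" using A Q by (simp add: C_def invertible_mult)
  have "congr C (mexp ((-s) *\<^sub>R Q)) = congr (pd_pow (1/2) A) (mat 1)"
    using congr_mexp[OF Q, of "s/2" "-s"] by (simp add: C_def congr_congr[symmetric])
  then have 1: "A = congr C (mexp ((-s) *\<^sub>R Q))"
    using A by (simp add: congr_def pd_pow_mult)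
  have "congr C (mexp ((1-s) *\<^sub>R Q)) = congr (pd_pow (1/2) A) (mexp Q)"
    using congr_mexp[OF Q, of "s/2" "1-s"] by (simp add: C_def congr_congr[symmetric])
  also have "\<dots> = B" using congr_pd_pow_inverse[OF A, of "1/2"] by (simp add: mQ)
  finally show ?thesis using that C Q 1 by metis
qed

lemma riem_dist_mexp_scaleR:
  assumes "hermitian_mat Q"
  shows "riem_dist (mexp (s *\<^sub>R Q)) (mexp (t *\<^sub>R Q)) = \<bar>s - t\<bar> * norm Q"
proof -
  have "pd_pow (-1/2) (mexp (s *\<^sub>R Q)) = mexp ((-s/2) *\<^sub>R Q)"
    using assms by (simp add: pd_pow_mexp)
  moreover have "congr (mexp ((-s/2) *\<^sub>R Q)) (mexp (t *\<^sub>R Q)) = mexp ((t - s) *\<^sub>R Q)"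
    unfolding congr_mexp[OF assms] by (simp add: algebra_simps)
  ultimately show ?thesis using assms by (simp add: riem_dist_eq abs_minus_commute)
qed

lemma riem_dist_commute:
  assumes "posdef A" "posdef B"
  shows "riem_dist A B = riem_dist B A"
proof -
  obtain C Q where *: "invertible C" "hermitian_mat Q"
    "A = congr C (mexp ((-0) *\<^sub>R Q))" "B = congr C (mexp ((1 - 0) *\<^sub>R Q))"
    using geodesic_normal_form[OF assms] by blast
  then show ?thesis
    using riem_dist_mexp_scaleR[OF *(2), of 0 1] riem_dist_mexp_scaleR[OF *(2), of 1 0]
    by (simp add: riem_dist_congr)
qed

section \<open>Nonpositive curvature\<close>

text \<open>If \<open>e\<^sup>x\<close> runs through the eigenvalues of \<open>A\<^sup>-\<^sup>1B\<close>, then \<open>sdiv A B\<close> is the sum of the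
  \<open>(2 sinh (x/2))\<^sup>2\<close>, whereas the squared Riemannian distance is the sum of the \<open>x\<^sup>2\<close>.\<close>

definition sdiv :: "complex^'m^'m \<Rightarrow> complex^'m^'m \<Rightarrow> real" where
  "sdiv A B = Re (trace (matrix_inv A ** B)) + Re (trace (matrix_inv B ** A)) - 2 * CARD('m)"

lemma matrix_inv_eqI:
  assumes "A ** B = mat 1"
  shows "matrix_inv A = (B :: complex^'m^'m)"
proof -
  have BA: "B ** A = mat 1" using assms matrix_left_right_inverse by blast
  have "A ** matrix_inv A = mat 1 \<and> matrix_inv A ** A = mat 1"
    unfolding matrix_inv_def by (rule someI[of _ B]) (simp add: assms BA)
  then show ?thesis by (metis BA matrix_mul_assoc matrix_mul_lid matrix_mul_rid)
qed

text \<open>The congruence turns \<open>matrix_inv A ** B\<close> into a similar matrix, which has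
  the same trace.\<close>

lemma sdiv_congr:
  assumes C: "invertible C" and A: "invertible A" and B: "invertible B"
  shows "sdiv (congr C A) (congr C B) = sdiv A B"
proof -
  obtain D where D: "D ** C = mat 1" "C ** D = mat 1" using C invertible_def by blast
  then have D': "adjoint_mat C ** adjoint_mat D = mat 1" by (metis adjoint_mult adjoint_one)
  have *: "trace (matrix_inv (congr C A) ** congr C B) = trace (matrix_inv A ** B)"
    if A: "invertible A" for A B
  proof -
    obtain A' where A': "A ** A' = mat 1" using A invertible_def by blast
    have "congr C A ** (adjoint_mat D ** A' ** D) = C ** (A ** (adjoint_mat C ** adjoint_mat D) ** A') ** D"
      by (simp add: congr_def matrix_mul_assoc)
    also have "\<dots> = mat 1" by (simp add: D D' A')
    finally have inv: "matrix_inv (congr C A) = adjoint_mat D ** A' ** D" by (rule matrix_inv_eqI)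
    have "trace (matrix_inv (congr C A) ** congr C B)
        = trace ((adjoint_mat D ** A') ** ((D ** C) ** B ** adjoint_mat C))"
      unfolding inv by (simp add: congr_def matrix_mul_assoc)
    also have "\<dots> = trace ((B ** adjoint_mat C) ** (adjoint_mat D ** A'))"
      by (subst trace_mul_sym) (simp add: D)
    also have "\<dots> = trace (B ** ((adjoint_mat C ** adjoint_mat D) ** A'))"
      by (simp add: matrix_mul_assoc)
    also have "\<dots> = trace (matrix_inv A ** B)"
      by (simp add: D' matrix_inv_eqI[OF A'] trace_mul_sym[of B])
    finally show ?thesis .
  qed
  show ?thesis using *[OF A] *[OF B] by (simp add: sdiv_def)
qed

lemma sinh_half_power2: "(2 * sinh ((x - y) / 2))\<^sup>2 = exp (x - y) + exp (y - x) - (2::real)"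
proof -
  have "2 * sinh z = exp z - exp (- z)" for z :: real
    by (simp add: sinh_field_def)
  then have "(2 * sinh ((x - y) / 2))\<^sup>2 = (exp ((x - y) / 2) - exp ((y - x) / 2))\<^sup>2"
    by (simp add: minus_divide_left)
  also have "\<dots> = exp ((x - y) / 2 + (x - y) / 2) + exp ((y - x) / 2 + (y - x) / 2)
      - 2 * exp ((x - y) / 2 + (y - x) / 2)"
    unfolding exp_add by (simp add: power2_eq_square algebra_simps)
  also have "\<dots> = exp (x - y) + exp (y - x) - 2"
    by (simp only: field_sum_of_halves) (simp flip: add_divide_distrib)
  finally show ?thesis .
qed

text \<open>Each trace is the inner product of a spectral form with eigenvalues
  \<open>exp (- h i)\<close> and one with eigenvalues \<open>exp (k j)\<close>, or the reverse, so
  \<open>inner_spec\<close> expands it. The constant \<open>2 * CARD('m)\<close> is spread over the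
  weights, whose total is the dimension.\<close>

lemma sdiv_mexp_spec:
  fixes U V :: "complex^'m^'m"
  assumes U: "unitary_mat U" and V: "unitary_mat V"
  shows "sdiv (mexp (spec U h)) (mexp (spec V k))
    = (\<Sum>i\<in>UNIV. \<Sum>j\<in>UNIV. transition U V i j * (2 * sinh ((h i - k j) / 2))\<^sup>2)"
proof -
  have inv: "matrix_inv (mexp (spec W l)) = spec W (\<lambda>i. exp (- l i))"
    if W: "unitary_mat W" for W :: "complex^'m^'m" and l
    by (rule matrix_inv_eqI) (simp add: W mexp_spec spec_mult spec_one flip: exp_add)
  have tr: "Re (trace (spec W d ** spec W' e)) = spec W d \<bullet> spec W' e" for W W' :: "complex^'m^'m" and d e
    by (simp add: inner_eq_trace)
  let ?s = "\<lambda>f. \<Sum>i\<in>UNIV. \<Sum>j\<in>UNIV. transition U V i j * f i j"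
  have 1: "?s (\<lambda>i j. exp (k j - h i)) = Re (trace (matrix_inv (mexp (spec U h)) ** mexp (spec V k)))"
    unfolding inv[OF U] mexp_spec[OF V] tr inner_spec[OF U V] by (simp flip: exp_add)
  have 2: "?s (\<lambda>i j. exp (h i - k j)) = Re (trace (matrix_inv (mexp (spec V k)) ** mexp (spec U h)))"
    unfolding inv[OF V] mexp_spec[OF U] tr inner_spec[OF V U]
    by (subst sum.swap) (simp add: transition_commute[of U V] flip: exp_add)
  have 3: "?s (\<lambda>i j. 2) = 2 * CARD('m)"
    by (simp add: transition_row_sum[OF U V] flip: sum_distrib_right)
  have "?s (\<lambda>i j. (2 * sinh ((h i - k j) / 2))\<^sup>2)
    = ?s (\<lambda>i j. exp (k j - h i)) + ?s (\<lambda>i j. exp (h i - k j)) - ?s (\<lambda>i j. 2)"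
    unfolding sinh_half_power2 by (simp add: algebra_simps flip: sum.distrib sum_subtractf)
  then show ?thesis by (simp add: 1 2 3 sdiv_def)
qed

section \<open>The exponential metric increasing property\<close>

lemma sinh_scaled_tendsto: "((\<lambda>y. sinh (x * y) / y) \<longlongrightarrow> x) (at 0)" for x :: real
proof -
  have "((\<lambda>y. sinh (x * y)) has_real_derivative (cosh (x * 0) * x)) (at 0)"
    by (auto intro!: derivative_eq_intros)
  then show ?thesis by (simp add: DERIV_def)
qed

lemma abs_le_abs_sinh: "\<bar>x\<bar> \<le> \<bar>sinh x\<bar>" for x :: real
proof -
  have "y \<le> sinh y" if "0 \<le> y" for y :: real
  proof -
    have "(\<lambda>x. sinh x - x) 0 \<le> (\<lambda>x. sinh x - x) y"
    proof (rule DERIV_nonneg_imp_nondecreasing[OF that])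
      fix x :: real
      have "((\<lambda>x. sinh x - x) has_real_derivative (cosh x - 1)) (at x)"
        by (auto intro!: derivative_eq_intros)
      moreover have "0 \<le> cosh x - 1" by (simp add: cosh_real_ge_1)
      ultimately show "\<exists>z. ((\<lambda>x. sinh x - x) has_real_derivative z) (at x) \<and> 0 \<le> z" by blast
    qed
    then show ?thesis by simp
  qed
  from this[of "\<bar>x\<bar>"] show ?thesis by (cases "0 \<le> x") (auto simp: abs_if)
qed

lemma power2_le_sinh: "x\<^sup>2 \<le> (2 * sinh (x / 2))\<^sup>2" for x :: real
  using abs_le_abs_sinh[of "x/2"] by (subst abs_le_square_iff[symmetric]) (simp add: abs_mult)

lemma norm_pd_log_diff_le_sdiv:
  assumes "posdef A" "posdef B"
  shows "(norm (pd_log A - pd_log B))\<^sup>2 \<le> sdiv A B"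
proof -
  obtain U h V k where U: "unitary_mat U" "pd_log A = spec U h" and V: "unitary_mat V" "pd_log B = spec V k"
    by (metis hermitian_pd_log hermitian_spectral)
  have "(norm (pd_log A - pd_log B))\<^sup>2 \<le> sdiv (mexp (spec U h)) (mexp (spec V k))"
    unfolding U(2) V(2) sdiv_mexp_spec[OF U(1) V(1)] norm_spec_diff[OF U(1) V(1)]
    by (intro sum_mono mult_left_mono power2_le_sinh) simp
  then show ?thesis by (simp add: assms flip: U(2) V(2))
qed

lemma posdef_invertible: "posdef A \<Longrightarrow> invertible A"
  using invertible_pd_pow[of A 1] by simp

text \<open>Once \<open>A\<close> is moved to the identity its logarithm vanishes, and
  \<open>norm_pd_log_diff_le_sdiv\<close> bounds the distance itself. Congruence invariance of
  \<open>sdiv\<close> carries the bound back.\<close>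

lemma riem_dist_le_sdiv:
  assumes A: "posdef A" and B: "posdef B"
  shows "(riem_dist A B)\<^sup>2 \<le> sdiv A B"
proof -
  let ?C = "pd_pow (-1/2) A"
  have "congr ?C A = mat 1" using congr_pd_pow[OF A, of "-1/2" 1] A by simp
  then have "(riem_dist A B)\<^sup>2 \<le> sdiv (congr ?C A) (congr ?C B)"
    using norm_pd_log_diff_le_sdiv[of "congr ?C A" "congr ?C B"] A B
    unfolding riem_dist_eq[OF A B] by simp
  then show ?thesis using A B sdiv_congr[of ?C A B] by (simp add: posdef_invertible)
qed

text \<open>Subdividing the geodesic from \<open>A\<close> to \<open>B\<close> into \<open>n\<close> equal parts and applying
  \<open>norm_pd_log_diff_le_sdiv\<close> to each of them loses only a factor tending to \<open>1\<close>.\<close>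

lemma norm_pd_log_diff_le_riem_dist:
  assumes A: "posdef A" and B: "posdef B"
  shows "norm (pd_log A - pd_log B) \<le> riem_dist A B"
proof -
  obtain C Q where C: "invertible C" and Q: "hermitian_mat Q" and
    ends: "A = congr C (mexp ((-0) *\<^sub>R Q))" "B = congr C (mexp ((1 - 0) *\<^sub>R Q))"
    using geodesic_normal_form[OF A B] by blast
  obtain U q where U: "unitary_mat U" "Q = spec U q" using Q by (rule hermitian_spectral)
  define G where "G = (\<lambda>t. congr C (mexp (t *\<^sub>R Q)))"
  have G: "posdef (G t)" for t using C Q by (simp add: G_def posdef_congr)
  have AB: "A = G 0" "B = G 1" using ends by (simp_all add: G_def)
  have sd: "sdiv (G s) (G t) = (\<Sum>i\<in>UNIV. (2 * sinh ((s * q i - t * q i) / 2))\<^sup>2)" for s t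
    using C Q U(1) unfolding G_def
    by (simp add: sdiv_congr U(2) scaleR_spec sdiv_mexp_spec transition_self if_distrib if_distribR cong: if_cong)
  define D where "D = (\<Sum>i\<in>UNIV. (q i)\<^sup>2)"
  \<comment> \<open>\<open>S n\<close> is the square of \<open>n\<close> times the divergence across
    one of \<open>n\<close> equal pieces of the geodesic; it tends to \<open>D\<close>, the squared
    length.\<close>
  define S where "S = (\<lambda>n::nat. \<Sum>i\<in>UNIV. (2 * real n * sinh (q i / (2 * real n)))\<^sup>2)"
  have rd: "riem_dist A B = sqrt D"
    using riem_dist_mexp_scaleR[OF Q, of 0 1] C Q norm_spec[OF U(1), of q]
    by (simp add: ends riem_dist_congr D_def real_sqrt_unique flip: U(2))
  have le: "norm (pd_log A - pd_log B) \<le> sqrt (S n)" if n: "n > 0" for n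
  proof -
    let ?L = "\<lambda>k. pd_log (G (real k / real n))"
    have step: "norm (?L k - ?L (Suc k)) \<le> sqrt (S n) / n" for k
    proof -
      have *: "(real k / real n) * x - (real (Suc k) / real n) * x = - (x / real n)" for x
        using n by (simp add: field_simps)
      have "sdiv (G (real k / real n)) (G (real (Suc k) / real n)) = (\<Sum>i\<in>UNIV. (2 * sinh (q i / (2 * real n)))\<^sup>2)"
        unfolding sd * by (simp add: mult.commute)
      also have "\<dots> = S n / (real n)\<^sup>2"
        using n by (simp add: S_def sum_divide_distrib power_mult_distrib)
      finally have "(norm (?L k - ?L (Suc k)))\<^sup>2 \<le> S n / (real n)\<^sup>2"
        using norm_pd_log_diff_le_sdiv[OF G G] by metis
      then have "norm (?L k - ?L (Suc k)) \<le> sqrt (S n / (real n)\<^sup>2)" by (rule real_le_rsqrt)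
      then show ?thesis by (simp add: real_sqrt_divide)
    qed
    \<comment> \<open>Telescoping: the Euclidean triangle inequality adds up the pieces, and
      \<open>m = n\<close> reaches the other end.\<close>
    have "norm (?L 0 - ?L m) \<le> m * (sqrt (S n) / n)" for m
    proof (induction m)
      case (Suc m)
      have "norm (?L 0 - ?L (Suc m)) \<le> norm (?L 0 - ?L m) + norm (?L m - ?L (Suc m))"
        using norm_triangle_ineq[of "?L 0 - ?L m" "?L m - ?L (Suc m)"]
        by (simp only: add_diff_eq diff_add_cancel)
      then show ?case using Suc.IH step[of m]
        by (simp only: of_nat_Suc distrib_right mult_1)
    qed simp
    from this[of n] show ?thesis using n by (simp add: AB)
  qed
  have "(\<lambda>n. 2 * real n * sinh (x / (2 * real n))) \<longlonglongrightarrow> x" for x :: real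
  proof -
    note sinh_scaled_tendsto[of x]
    moreover have "filterlim (\<lambda>n. 1 / (2 * real n)) (at 0) sequentially"
    proof (rule filterlim_atI)
      show "(\<lambda>n. 1 / (2 * real n)) \<longlonglongrightarrow> 0"
        using tendsto_mult_right_zero[OF lim_1_over_n, of "1/2"] by simp
      show "\<forall>\<^sub>F n in sequentially. 1 / (2 * real n) \<noteq> 0"
        using eventually_gt_at_top[of 0] by eventually_elim simp
    qed
    ultimately have "(\<lambda>n. sinh (x * (1 / (2 * real n))) / (1 / (2 * real n))) \<longlonglongrightarrow> x"
      by (rule filterlim_compose)
    then show ?thesis by (simp add: mult.commute)
  qed
  then have "(\<lambda>n. sqrt (S n)) \<longlonglongrightarrow> sqrt D"
    unfolding S_def D_def by (intro tendsto_intros)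
  then have "norm (pd_log A - pd_log B) \<le> sqrt D"
    by (rule LIMSEQ_le_const) (use le in \<open>auto intro!: exI[of _ 1]\<close>)
  then show ?thesis by (simp add: rd)
qed

text \<open>With \<open>A\<close> moved to the identity, distances from \<open>A\<close> are norms
  of logarithms. The triangle inequality of the norm then suffices, as the difference of the
  logarithms of the other two points is at most their distance.\<close>

lemma riem_dist_triangle:
  assumes A: "posdef A" and B: "posdef B" and C: "posdef C"
  shows "riem_dist A C \<le> riem_dist A B + riem_dist B C"
proof -
  let ?P = "pd_pow (-1/2) A"
  have I: "invertible ?P" using A by simp
  have one: "congr ?P A = mat 1" using congr_pd_pow[OF A, of "-1/2" 1] A by simp
  have pB: "posdef (congr ?P B)" and pC: "posdef (congr ?P C)" using A B C by simp_all
  have "norm (pd_log (congr ?P C)) \<le> norm (pd_log (congr ?P B)) + riem_dist (congr ?P B) (congr ?P C)"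
    using norm_pd_log_diff_le_riem_dist[OF pB pC] norm_triangle_ineq2[of "pd_log (congr ?P C)" "pd_log (congr ?P B)"]
    by (simp add: norm_minus_commute)
  then show ?thesis
    using riem_dist_congr[OF I B C] by (simp add: riem_dist_eq[OF A B] riem_dist_eq[OF A C])
qed

lemma riem_dist_self [simp]: "posdef A \<Longrightarrow> riem_dist A A = 0"
  using riem_dist_mexp_scaleR[of "pd_log A" 1 1] by simp

lemma riem_dist_eq_0_imp_eq:
  assumes "posdef A" "posdef B" "riem_dist A B = 0" shows "A = B"
proof -
  have "pd_log A = pd_log B" using norm_pd_log_diff_le_riem_dist[OF assms(1,2)] assms(3) by simp
  then show ?thesis using assms by (metis mexp_pd_log)
qed

text \<open>Place the dividing point of the geodesic at the identity. Distances from it, and along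
  the geodesic, become Euclidean, while the Euclidean distances from \<open>Z\<close> to the end
  points underestimate the Riemannian ones; the Euclidean identity thus turns into the
  inequality.\<close>

lemma riem_dist_semiparallelogram:
  assumes A: "posdef A" and B: "posdef B" and s: "0 \<le> s" "s \<le> 1"
  obtains M where "posdef M" "\<And>Z. posdef Z \<Longrightarrow> (riem_dist Z M)\<^sup>2
    \<le> (1 - s) * (riem_dist Z A)\<^sup>2 + s * (riem_dist Z B)\<^sup>2 - s * (1 - s) * (riem_dist A B)\<^sup>2"
proof -
  obtain C Q where C: "invertible C" and Q: "hermitian_mat Q" and
    ends: "A = congr C (mexp ((-s) *\<^sub>R Q))" "B = congr C (mexp ((1 - s) *\<^sub>R Q))"
    using geodesic_normal_form[OF A B] by blast
  obtain C' where C': "C ** C' = mat 1" "C' ** C = mat 1" using C invertible_def by blast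
  have ineq: "(riem_dist Z (congr C (mat 1)))\<^sup>2
    \<le> (1 - s) * (riem_dist Z A)\<^sup>2 + s * (riem_dist Z B)\<^sup>2 - s * (1 - s) * (riem_dist A B)\<^sup>2"
    if Z: "posdef Z" for Z
  proof -
    define K where "K = pd_log (congr C' Z)"
    have "invertible C'" using C' invertible_def by blast
    then have K: "hermitian_mat K" "Z = congr C (mexp K)"
      using Z by (simp_all add: K_def posdef_congr congr_congr C')
    have M: "riem_dist Z (congr C (mat 1)) = norm K"
      using K C by (simp add: riem_dist_congr riem_dist_commute[of "mexp K"] riem_dist_one)
    have le: "norm (K - t *\<^sub>R Q) \<le> riem_dist Z (congr C (mexp (t *\<^sub>R Q)))" for t
      using norm_pd_log_diff_le_riem_dist[of "mexp K" "mexp (t *\<^sub>R Q)"] K C Q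
      by (simp add: riem_dist_congr)
    have AB: "riem_dist A B = norm Q"
      using riem_dist_mexp_scaleR[OF Q, of "-s" "1-s"] C Q by (simp add: ends riem_dist_congr)
    \<comment> \<open>Stewart's identity for the segment from \<open>(-s) *\<^sub>R Q\<close> to
      \<open>(1 - s) *\<^sub>R Q\<close>, which passes through 0 at parameter
      \<open>s\<close>.\<close>
    have "(norm K)\<^sup>2 + s * (1 - s) * (norm Q)\<^sup>2
      = (1 - s) * (norm (K - (-s) *\<^sub>R Q))\<^sup>2 + s * (norm (K - (1 - s) *\<^sub>R Q))\<^sup>2"
      unfolding power2_norm_eq_inner
      by (simp add: inner_diff inner_add inner_commute algebra_simps power2_eq_square power3_eq_cube)
    also have "\<dots> \<le> (1 - s) * (riem_dist Z A)\<^sup>2 + s * (riem_dist Z B)\<^sup>2"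
      unfolding ends using s by (intro add_mono mult_left_mono power_mono le) auto
    finally show ?thesis by (simp add: M AB)
  qed
  have "posdef (congr C (mat 1))" using C by (simp add: posdef_congr)
  then show ?thesis using ineq by (rule that)
qed

text \<open>Reshetnyak's quadruple inequality, obtained from the point that divides the diagonal from \<open>A\<close>
  to \<open>C\<close> in the ratio \<open>d(A, B) : d(C, D)\<close>.\<close>

lemma riem_dist_quadruple:
  assumes p: "posdef A" "posdef B" "posdef C" "posdef D"
  shows "(riem_dist A C)\<^sup>2 + (riem_dist B D)\<^sup>2
    \<le> (riem_dist B C)\<^sup>2 + (riem_dist A D)\<^sup>2 + 2 * riem_dist A B * riem_dist C D"
proof (cases "riem_dist A B = 0 \<or> riem_dist C D = 0")
  case True
  then have "A = B \<or> C = D" using riem_dist_eq_0_imp_eq p by blast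
  then show ?thesis using p by (auto simp: riem_dist_commute)
next
  case False
  define a b where "a = riem_dist A B" and "b = riem_dist C D"
  have ab: "a > 0" "b > 0" using False by (simp_all add: a_def b_def less_le)
  \<comment> \<open>This ratio makes both \<open>(1 - s) / s * a\<^sup>2\<close> and
    \<open>s / (1 - s) * b\<^sup>2\<close> equal to \<open>a * b\<close>.\<close>
  define s where "s = a / (a + b)"
  have s: "0 < s" "s < 1" "1 - s = b / (a + b)" using ab by (simp_all add: s_def field_simps)
  obtain M where M: "posdef M" "\<And>Z. posdef Z \<Longrightarrow> (riem_dist Z M)\<^sup>2
    \<le> (1 - s) * (riem_dist Z A)\<^sup>2 + s * (riem_dist Z C)\<^sup>2 - s * (1 - s) * (riem_dist A C)\<^sup>2"
    using riem_dist_semiparallelogram[OF p(1,3)] s by (metis less_imp_le)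
  define x y where "x = riem_dist B M" and "y = riem_dist D M"
  have "riem_dist B D \<le> x + y"
    using riem_dist_triangle[OF p(2) M(1) p(4)] riem_dist_commute[OF M(1) p(4)] by (simp add: x_def y_def)
  then have "(riem_dist B D)\<^sup>2 \<le> (x + y)\<^sup>2" by (simp add: power_mono)
  also have "\<dots> \<le> x\<^sup>2 / s + y\<^sup>2 / (1 - s)"
  proof -
    \<comment> \<open>Weighted Cauchy-Schwarz; the defect is an explicit square.\<close>
    have "x\<^sup>2 / s + y\<^sup>2 / (1 - s) - (x + y)\<^sup>2 = ((1 - s) * x - s * y)\<^sup>2 / (s * (1 - s))"
      using s(1,2) by (simp add: power2_eq_square field_simps)
    moreover have "\<dots> \<ge> 0" using s(1,2) by simp
    ultimately show ?thesis by linarith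
  qed
  also have "\<dots> \<le> ((1 - s) * (riem_dist B A)\<^sup>2 + s * (riem_dist B C)\<^sup>2 - s * (1 - s) * (riem_dist A C)\<^sup>2) / s
     + ((1 - s) * (riem_dist D A)\<^sup>2 + s * (riem_dist D C)\<^sup>2 - s * (1 - s) * (riem_dist A C)\<^sup>2) / (1 - s)"
    unfolding x_def y_def using s p by (intro add_mono divide_right_mono M(2)) auto
  also have "\<dots> = (1 - s) / s * a\<^sup>2 + (riem_dist B C)\<^sup>2 + (riem_dist A D)\<^sup>2 + s / (1 - s) * b\<^sup>2 - (riem_dist A C)\<^sup>2"
  proof -
    have "((1 - s) * u + s * v - s * (1 - s) * w) / s = (1 - s) / s * u + v - (1 - s) * w" for u v w
      using s(1,2) by (simp add: field_simps)
    moreover have "((1 - s) * u + s * v - s * (1 - s) * w) / (1 - s) = u + s / (1 - s) * v - s * w" for u v w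
    proof -
      have *: "(1 - s) * u + s * v - s * (1 - s) * w = (1 - s) * (u - s * w) + s * v"
        by (simp add: algebra_simps)
      show ?thesis unfolding * using s(1,2) by (simp add: add_divide_distrib)
    qed
    ultimately show ?thesis using p
      by (simp add: a_def b_def riem_dist_commute[of B A] riem_dist_commute[of D A]
          riem_dist_commute[of D C] left_diff_distrib)
  qed
  also have "(1 - s) / s * a\<^sup>2 = a * b"
    using ab unfolding s(3) unfolding s_def by (simp add: power2_eq_square)
  also have "s / (1 - s) * b\<^sup>2 = a * b"
    using ab unfolding s(3) unfolding s_def by (simp add: power2_eq_square)
  finally show ?thesis by (simp add: a_def b_def)
qed

section \<open>Continuity and measurability\<close>

lemma exp_diff_le:
  assumes "\<bar>a\<bar> \<le> R" "\<bar>b\<bar> \<le> (R::real)"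
  shows "\<bar>exp a - exp b\<bar> \<le> exp R * \<bar>a - b\<bar>"
proof -
  have *: "exp y - exp x \<le> exp R * (y - x)" if "x \<le> y" "y \<le> R" for x y
  proof -
    have "exp y - exp x = exp y * (1 - exp (x - y))" by (simp add: exp_diff right_diff_distrib)
    also have "\<dots> \<le> exp y * (y - x)" using exp_ge_add_one_self[of "x - y"] by (intro mult_left_mono; linarith?) simp
    also have "\<dots> \<le> exp R * (y - x)" using that by (intro mult_right_mono) auto
    finally show ?thesis .
  qed
  have "a \<le> R" "b \<le> R" using assms by auto
  then show ?thesis using *[of a b] *[of b a] by (cases "a \<le> b") auto
qed

text \<open>Both norms are sums with the same transition weights, so a scalar Lipschitz bound on
  pairs of eigenvalues passes to the functional calculus with the same constant.\<close>

lemma norm_spec_diff_le: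
  fixes U V :: "complex^'m^'m"
  assumes U: "unitary_mat U" and V: "unitary_mat V" and c: "0 \<le> c"
    and le: "\<And>i j. \<bar>d' i - e' j\<bar> \<le> c * \<bar>d i - e j\<bar>"
  shows "norm (spec U d' - spec V e') \<le> c * norm (spec U d - spec V e)"
proof -
  have "(norm (spec U d' - spec V e'))\<^sup>2
      \<le> (\<Sum>i\<in>UNIV. \<Sum>j\<in>UNIV. transition U V i j * (c * \<bar>d i - e j\<bar>)\<^sup>2)"
    unfolding norm_spec_diff[OF U V]
    by (intro sum_mono mult_left_mono) (auto simp: abs_le_square_iff[symmetric] abs_mult c le)
  also have "\<dots> = (c * norm (spec U d - spec V e))\<^sup>2"
    unfolding power_mult_distrib norm_spec_diff[OF U V]
    by (simp add: sum_distrib_left mult_ac)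
  finally show ?thesis by (rule power2_le_imp_le) (simp add: c)
qed

lemma abs_le_norm_spec: "unitary_mat U \<Longrightarrow> \<bar>d i\<bar> \<le> norm (spec U d)"
  by (rule power2_le_imp_le) (auto simp: norm_spec intro!: member_le_sum)

lemma norm_mexp_diff_le:
  assumes "hermitian_mat H" "hermitian_mat K" "norm H \<le> R" "norm K \<le> R"
  shows "norm (mexp H - mexp K) \<le> exp R * norm (H - K)"
proof -
  obtain U h V k where U: "unitary_mat U" "H = spec U h" and V: "unitary_mat V" "K = spec V k"
    using assms(1,2) by (metis hermitian_spectral)
  have "\<bar>h i\<bar> \<le> R" "\<bar>k i\<bar> \<le> R" for i
    using abs_le_norm_spec[OF U(1), of h i] abs_le_norm_spec[OF V(1), of k i] assms U V by auto
  then show ?thesis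
    unfolding U(2) V(2) mexp_spec[OF U(1)] mexp_spec[OF V(1)]
    by (intro norm_spec_diff_le U V exp_diff_le) auto
qed

lemma continuous_on_mexp: "continuous_on {H. hermitian_mat H} mexp"
proof (rule continuous_onI)
  fix H :: "complex^'m^'m" and e :: real
  assume H: "H \<in> {H. hermitian_mat H}" and e: "e > 0"
  define R where "R = norm H + 1"
  define \<delta> where "\<delta> = min 1 (e / exp R)"
  show "\<exists>d>0. \<forall>K\<in>{H. hermitian_mat H}. dist K H < d \<longrightarrow> dist (mexp K) (mexp H) \<le> e"
  proof (intro exI[of _ \<delta>] conjI ballI impI)
    show "\<delta> > 0" using e by (simp add: \<delta>_def)
    fix K :: "complex^'m^'m" assume K: "K \<in> {H. hermitian_mat H}" "dist K H < \<delta>"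
    then have d: "norm (K - H) \<le> 1" "norm (K - H) \<le> e / exp R" by (auto simp: \<delta>_def dist_norm)
    then have "norm K \<le> R" using norm_triangle_sub[of K H] by (simp add: R_def)
    then have "dist (mexp K) (mexp H) \<le> exp R * norm (K - H)"
      using H K unfolding dist_norm by (intro norm_mexp_diff_le) (auto simp: R_def)
    also have "\<dots> \<le> e" using d(2) by (simp add: field_simps)
    finally show "dist (mexp K) (mexp H) \<le> e" .
  qed
qed

text \<open>A converse on bounded sets to \<open>norm_pd_log_diff_le_riem_dist\<close>: the distance
  is bounded through \<open>sdiv\<close>, whose hyperbolic sines are Lipschitz there.\<close>

lemma riem_dist_mexp_le:
  assumes "hermitian_mat H" "hermitian_mat K" "norm H \<le> R" "norm K \<le> R"
  shows "riem_dist (mexp H) (mexp K) \<le> exp R * norm (H - K)"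
proof -
  obtain U h V k where U: "unitary_mat U" "H = spec U h" and V: "unitary_mat V" "K = spec V k"
    using assms(1,2) by (metis hermitian_spectral)
  have hk: "\<bar>h i\<bar> \<le> R" "\<bar>k i\<bar> \<le> R" for i
    using abs_le_norm_spec[OF U(1), of h i] abs_le_norm_spec[OF V(1), of k i] assms U V by auto
  have le: "\<bar>2 * sinh ((h i - k j) / 2)\<bar> \<le> exp R * \<bar>h i - k j\<bar>" for i j
  proof -
    have "2 * sinh z = exp z - exp (- z)" for z :: real by (simp add: sinh_field_def)
    then have "\<bar>2 * sinh ((h i - k j) / 2)\<bar> = \<bar>exp ((h i - k j) / 2) - exp (- ((h i - k j) / 2))\<bar>" by simp
    also have "\<dots> \<le> exp R * \<bar>(h i - k j) / 2 - - ((h i - k j) / 2)\<bar>"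
      using hk[of i] hk[of j] by (intro exp_diff_le) auto
    finally show ?thesis by simp
  qed
  have "(riem_dist (mexp H) (mexp K))\<^sup>2 \<le> sdiv (mexp H) (mexp K)"
    using assms by (intro riem_dist_le_sdiv) auto
  also have "\<dots> \<le> (\<Sum>i\<in>UNIV. \<Sum>j\<in>UNIV. transition U V i j * (exp R * \<bar>h i - k j\<bar>)\<^sup>2)"
    unfolding U(2) V(2) sdiv_mexp_spec[OF U(1) V(1)]
    using power_mono[OF le abs_ge_zero, of _ _ 2] unfolding power2_abs
    by (intro sum_mono mult_left_mono) auto
  also have "\<dots> = (exp R * norm (H - K))\<^sup>2"
    unfolding power_mult_distrib U(2) V(2) norm_spec_diff[OF U(1) V(1)]
    by (simp add: sum_distrib_left mult_ac)
  finally show ?thesis by (rule power2_le_imp_le) simp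
qed

text \<open>The Hermitian matrices whose eigenvalues are all at least \<open>c\<close>. These sets
  are closed, \<open>pd_log\<close> is Lipschitz on them for \<open>c > 0\<close>, and countably
  many of them exhaust the positive definite cone.\<close>

definition posdef_ge :: "real \<Rightarrow> (complex^'m^'m) set" where
  "posdef_ge c = {A. hermitian_mat A \<and> (\<forall>x. c * (norm x)\<^sup>2 \<le> x \<bullet> (A *v x))}"

lemma closed_hermitian: "closed {A :: complex^'m^'m. hermitian_mat A}"
  unfolding hermitian_mat_def adjoint_mat_def vec_eq_iff
  by (simp, intro closed_Collect_all closed_Collect_eq continuous_intros)

lemma closed_posdef_ge: "closed (posdef_ge c :: (complex^'m^'m) set)"
proof -
  have *: "continuous_on UNIV (\<lambda>A :: complex^'m^'m. x \<bullet> (A *v x))" for x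
    unfolding matrix_vector_mult_def by (intro continuous_intros)
  have "closed {A :: complex^'m^'m. \<forall>x. c * (norm x)\<^sup>2 \<le> x \<bullet> (A *v x)}"
    by (intro closed_Collect_all closed_Collect_le continuous_on_const *)
  then show ?thesis
    unfolding posdef_ge_def Collect_conj_eq by (intro closed_Int closed_hermitian)
qed

lemma norm_unitary_vec: "unitary_mat U \<Longrightarrow> norm (U *v x) = norm x"
proof -
  assume "unitary_mat U"
  then have "hinner (U *v x) (U *v x) = hinner x x"
    by (simp add: hinner_adjoint matrix_vector_mul_assoc unitary_left)
  then show ?thesis by (metis Re_hinner norm_eq_sqrt_inner)
qed

lemma posdef_ge_spec_iff:
  assumes U: "unitary_mat U"
  shows "spec U d \<in> posdef_ge c \<longleftrightarrow> (\<forall>i. c \<le> d i)"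
proof -
  have "x \<bullet> (spec U d *v x) - c * (norm x)\<^sup>2
      = (\<Sum>i\<in>UNIV. (d i - c) * (cmod ((adjoint_mat U *v x) $ i))\<^sup>2)" for x
  proof -
    have "(norm x)\<^sup>2 = (\<Sum>i\<in>UNIV. (cmod ((adjoint_mat U *v x) $ i))\<^sup>2)"
      using norm_unitary_vec[OF unitary_adjoint[OF U], of x]
      by (simp add: norm_vec_def L2_set_def sum_nonneg flip: real_sqrt_pow2)
    then show ?thesis
      by (simp add: inner_spec_vec left_diff_distrib sum_subtractf sum_distrib_left)
  qed
  note * = this
  show ?thesis
  proof
    assume "spec U d \<in> posdef_ge c"
    then have ge: "0 \<le> (\<Sum>i\<in>UNIV. (d i - c) * (cmod ((adjoint_mat U *v x) $ i))\<^sup>2)" for x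
      by (simp add: posdef_ge_def flip: *)
    show "\<forall>i. c \<le> d i"
    proof
      fix i
      have "adjoint_mat U *v (U *v axis i 1) = axis i 1"
        by (simp add: matrix_vector_mul_assoc unitary_left[OF U])
      then show "c \<le> d i"
        using ge[of "U *v axis i 1"] by (simp add: axis_def if_distrib if_distribR cong: if_cong)
    qed
  next
    assume "\<forall>i. c \<le> d i"
    then have "0 \<le> x \<bullet> (spec U d *v x) - c * (norm x)\<^sup>2" for x
      unfolding * by (intro sum_nonneg mult_nonneg_nonneg) auto
    then show "spec U d \<in> posdef_ge c" by (simp add: posdef_ge_def)
  qed
qed

lemma posdef_iff_posdef_ge: "posdef A \<longleftrightarrow> (\<exists>n::nat. A \<in> posdef_ge (1 / Suc n))"
proof
  assume A: "posdef A"
  obtain U d where U: "unitary_mat U" "A = spec U d"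
    using posdef_hermitian[OF A] by (rule hermitian_spectral)
  have d: "0 < d i" for i using A U posdef_spec by blast
  define c where "c = Min (range d)"
  have "0 < c" "\<And>i. c \<le> d i" using d by (simp_all add: c_def)
  moreover obtain n where "inverse (of_nat (Suc n)) < c" using reals_Archimedean[OF \<open>0 < c\<close>] by blast
  ultimately have "\<forall>i. 1 / Suc n \<le> d i" by (metis inverse_eq_divide less_le_trans less_imp_le)
  then show "\<exists>n::nat. A \<in> posdef_ge (1 / Suc n)" using U posdef_ge_spec_iff by blast
next
  assume "\<exists>n::nat. A \<in> posdef_ge (1 / Suc n)"
  then obtain n where n: "A \<in> posdef_ge (1 / Suc n)" by blast
  then obtain U d where U: "unitary_mat U" "A = spec U d"
    unfolding posdef_ge_def using hermitian_spectral by blast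
  have "1 / real (Suc n) \<le> d i" for i using n U posdef_ge_spec_iff by blast
  moreover have "0 < 1 / real (Suc n)" by simp
  ultimately have "0 < d i" for i by (metis less_le_trans)
  then show "posdef A" using U posdef_spec by blast
qed

lemma pd_log_spec_eq:
  assumes "unitary_mat U" "\<forall>i. 0 < d i" shows "pd_log (spec U d) = spec U (\<lambda>i. ln (d i))"
  using assms by (simp add: pd_log_def posdef_spec mat_fun_spec)

lemma norm_pd_log_diff_le:
  assumes c: "0 < c" and A: "A \<in> posdef_ge c" and B: "B \<in> posdef_ge c"
  shows "norm (pd_log A - pd_log B) \<le> (1 / c) * norm (A - B)"
proof -
  obtain U d V e where U: "unitary_mat U" "A = spec U d" and V: "unitary_mat V" "B = spec V e"
    using A B unfolding posdef_ge_def by (metis (mono_tags, lifting) hermitian_spectral mem_Collect_eq)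
  have de: "c \<le> d i" "c \<le> e i" for i using A B U V posdef_ge_spec_iff by blast+
  then have pos: "0 < d i" "0 < e i" for i using c less_le_trans by blast+
  have *: "ln x - ln y \<le> (1 / c) * (x - y)" if "c \<le> y" "y \<le> x" for x y
  proof -
    have "ln x - ln y \<le> (x - y) / y" using that c by (intro ln_diff_le) auto
    also have "\<dots> \<le> (x - y) / c" using that c by (intro divide_left_mono) auto
    finally show ?thesis by simp
  qed
  have "\<bar>ln x - ln y\<bar> \<le> (1 / c) * \<bar>x - y\<bar>" if "c \<le> x" "c \<le> y" for x y
    using *[of x y] *[of y x] that c by (cases "x \<le> y") (auto simp: abs_if)
  then have "\<bar>ln (d i) - ln (e j)\<bar> \<le> (1 / c) * \<bar>d i - e j\<bar>" for i j using de by blast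
  moreover have "pd_log A = spec U (\<lambda>i. ln (d i))" "pd_log B = spec V (\<lambda>i. ln (e i))"
    using pos U V by (simp_all add: pd_log_spec_eq)
  ultimately show ?thesis
    unfolding U(2) V(2) using c by (simp only:) (intro norm_spec_diff_le U V, auto)
qed

lemma continuous_on_pd_log:
  assumes "0 < c" shows "continuous_on (posdef_ge c) pd_log"
proof (rule lipschitz_on_continuous_on)
  show "(1 / c)-lipschitz_on (posdef_ge c) pd_log"
    using norm_pd_log_diff_le assms by (intro lipschitz_onI) (auto simp: dist_norm)
qed

section \<open>Borel measurability\<close>

lemma sets_posdef [measurable]: "{A :: complex^'m^'m. posdef A} \<in> sets borel"
proof -
  have "{A :: complex^'m^'m. posdef A} = (\<Union>n::nat. posdef_ge (1 / Suc n))"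
    by (auto simp: posdef_iff_posdef_ge)
  also have "\<dots> \<in> sets borel" by (intro sets.countable_UN) (auto intro: borel_closed closed_posdef_ge)
  finally show ?thesis .
qed

lemma measurable_posdef [measurable]: "Measurable.pred borel (posdef :: complex^'m^'m \<Rightarrow> bool)"
  using sets_posdef by (simp add: pred_def)

text \<open>Countably many Borel pieces cover the space: \<open>pd_log\<close> is continuous on each
  \<open>posdef_ge (1 / Suc n)\<close> and takes its default value 0 off the cone.\<close>

lemma borel_measurable_pd_log [measurable]: "(pd_log :: complex^'m^'m \<Rightarrow> _) \<in> borel_measurable borel"
proof (rule measurable_piecewise_restrict)
  let ?C = "insert (- {A :: complex^'m^'m. posdef A}) (range (\<lambda>n::nat. posdef_ge (1 / Suc n)))"
  show "countable ?C" by simp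
  show "space borel \<subseteq> \<Union>?C" by (auto simp: posdef_iff_posdef_ge)
  fix S assume "S \<in> ?C"
  then consider "S = - {A. posdef A}" | n :: nat where "S = posdef_ge (1 / Suc n)" by blast
  then show "S \<inter> space borel \<in> sets borel"
  proof cases
    case 1
    then show ?thesis using sets_posdef by (auto intro: sets.compl_sets simp: Compl_eq_Diff_UNIV)
  qed (auto intro: borel_closed closed_posdef_ge)
  show "pd_log \<in> borel_measurable (restrict_space borel S)"
    using \<open>S \<in> ?C\<close>
  proof (elim insertE imageE)
    assume S: "S = - {A. posdef A}"
    show ?thesis
      by (subst measurable_cong[where g = "\<lambda>_. 0"]) (simp_all add: S pd_log_def space_restrict_space)
  next
    fix n :: nat assume "S = posdef_ge (1 / Suc n)"
    then show ?thesis
      by (simp only:) (intro borel_measurable_continuous_on_restrict continuous_on_pd_log, simp)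
  qed
qed

text \<open>Continuity of \<open>mexp\<close> is available on the Hermitian matrices only, so the
  composition passes through the restricted Borel space.\<close>

lemma borel_measurable_mexp:
  assumes f: "f \<in> borel_measurable M" and H: "\<And>x. hermitian_mat (f x)"
  shows "(\<lambda>x. mexp (f x)) \<in> borel_measurable M"
proof (rule measurable_compose[where f = f and g = mexp])
  show "f \<in> measurable M (restrict_space borel {A. hermitian_mat A})"
    using f H by (intro measurable_restrict_space2) auto
  show "mexp \<in> borel_measurable (restrict_space borel {A. hermitian_mat A})"
    by (intro borel_measurable_continuous_on_restrict continuous_on_mexp)
qed

lemma borel_measurable_congr [measurable]: "congr C \<in> borel_measurable borel"
proof (rule borel_measurable_continuous_onI)
  show "continuous_on UNIV (congr C)"
    unfolding congr_def by (intro matmul.continuous_on continuous_intros)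
qed

lemma borel_measurable_riem_dist [measurable]: "riem_dist Z \<in> borel_measurable borel"
proof (cases "posdef Z")
  case True
  have "riem_dist Z = (\<lambda>A. if posdef A then norm (pd_log (congr (pd_pow (-1/2) Z) A)) else 0)"
    using True riem_dist_eq[OF True] by (intro ext) (simp add: riem_dist_def)
  moreover have "\<dots> \<in> borel_measurable borel" by measurable
  ultimately show ?thesis by simp
next
  case False
  then have "riem_dist Z = (\<lambda>_. 0)" by (auto simp: riem_dist_def)
  then show ?thesis by simp
qed

section \<open>The Cartan barycenter\<close>

lemma
  assumes "\<nu> \<in> P1"
  shows P1_prob_space: "prob_space \<nu>"
    and P1_sets: "sets \<nu> = sets borel"
    and P1_AE_posdef: "AE A in \<nu>. posdef A"
  using assms by (auto simp: P1_def)

section \<open>Integrability from a finite first moment\<close>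

lemma riem_dist_triangle3:
  assumes "posdef A" "posdef B" "posdef C"
  shows "\<bar>riem_dist A C - riem_dist B C\<bar> \<le> riem_dist A B"
  using riem_dist_triangle[of A B C] riem_dist_triangle[of B A C] riem_dist_commute[of A B] assms
  by (auto simp: abs_if)

lemma riem_dist_power2_diff_le:
  assumes "posdef A" "posdef B" "posdef C"
  shows "\<bar>(riem_dist A C)\<^sup>2 - (riem_dist B C)\<^sup>2\<bar> \<le> riem_dist A B * (riem_dist A C + riem_dist B C)"
proof -
  have "(riem_dist A C)\<^sup>2 - (riem_dist B C)\<^sup>2 = (riem_dist A C - riem_dist B C) * (riem_dist A C + riem_dist B C)"
    by (simp add: power2_eq_square algebra_simps)
  then show ?thesis
    using riem_dist_triangle3[OF assms] by (simp add: abs_mult mult_right_mono)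
qed

lemma P1_integrable_riem_dist:
  assumes P: "\<nu> \<in> P1" and Y: "posdef Y"
  shows "integrable \<nu> (riem_dist Y)"
proof -
  interpret prob_space \<nu> using P by (rule P1_prob_space)
  note [measurable_cong] = P1_sets[OF P]
  obtain Y0 where Y0: "posdef Y0" "integrable \<nu> (\<lambda>Z. riem_dist Z Y0)"
    using P by (auto simp: P1_def)
  show ?thesis
  proof (rule Bochner_Integration.integrable_bound)
    show "integrable \<nu> (\<lambda>A. riem_dist Y Y0 + riem_dist A Y0)" using Y0 by simp
    show "riem_dist Y \<in> borel_measurable \<nu>" by measurable
    show "AE A in \<nu>. norm (riem_dist Y A) \<le> norm (riem_dist Y Y0 + riem_dist A Y0)"
      using P1_AE_posdef[OF P]
    proof eventually_elim
      case (elim A)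
      then show ?case using riem_dist_triangle[OF Y Y0(1) elim] riem_dist_commute[OF Y0(1) elim] by simp
    qed
  qed
qed

text \<open>A difference of squared distances grows only linearly in the distance, so a first moment
  is enough.\<close>

lemma P1_integrable_diff:
  assumes P: "\<nu> \<in> P1" and Y: "posdef Y" and Z: "posdef Z"
  shows "integrable \<nu> (\<lambda>A. (riem_dist Y A)\<^sup>2 - (riem_dist Z A)\<^sup>2)"
proof (rule Bochner_Integration.integrable_bound)
  note [measurable_cong] = P1_sets[OF P]
  show "integrable \<nu> (\<lambda>A. riem_dist Y Z * (riem_dist Y A + riem_dist Z A))"
    using P1_integrable_riem_dist[OF P] Y Z by simp
  show "(\<lambda>A. (riem_dist Y A)\<^sup>2 - (riem_dist Z A)\<^sup>2) \<in> borel_measurable \<nu>" by measurable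
  show "AE A in \<nu>. norm ((riem_dist Y A)\<^sup>2 - (riem_dist Z A)\<^sup>2)
      \<le> norm (riem_dist Y Z * (riem_dist Y A + riem_dist Z A))"
    using P1_AE_posdef[OF P]
  proof eventually_elim
    case (elim A)
    then show ?case using riem_dist_power2_diff_le[OF Y Z elim] by (simp add: abs_mult)
  qed
qed

text \<open>The functional minimised in \<open>cartan_bary\<close>. Subtracting the squared distance
  from the identity keeps it finite even when second moments are infinite.\<close>

definition cartan_objective :: "(complex^'m^'m) measure \<Rightarrow> complex^'m^'m \<Rightarrow> real" where
  "cartan_objective \<nu> Z = (\<integral>A. (riem_dist Z A)\<^sup>2 - (riem_dist (mat 1) A)\<^sup>2 \<partial>\<nu>)"

lemma cartan_objective_diff:
  assumes P: "\<nu> \<in> P1" and Y: "posdef Y" and Z: "posdef Z"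
  shows "cartan_objective \<nu> Y - cartan_objective \<nu> Z = (\<integral>A. (riem_dist Y A)\<^sup>2 - (riem_dist Z A)\<^sup>2 \<partial>\<nu>)"
  unfolding cartan_objective_def using P1_integrable_diff[OF P _ posdef_one] Y Z
  by (subst Bochner_Integration.integral_diff[symmetric]) auto

lemma cartan_objective_one: "cartan_objective \<nu> (mat 1) = 0"
  by (simp add: cartan_objective_def)

lemma cartan_objective_lipschitz:
  assumes P: "\<nu> \<in> P1" and Y: "posdef Y" and Z: "posdef Z"
    and r: "riem_dist (mat 1) Y \<le> R" "riem_dist (mat 1) Z \<le> R"
  shows "\<bar>cartan_objective \<nu> Y - cartan_objective \<nu> Z\<bar>
    \<le> riem_dist Y Z * (2 * R + 2 * (\<integral>A. riem_dist (mat 1) A \<partial>\<nu>))"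
proof -
  interpret prob_space \<nu> using P by (rule P1_prob_space)
  note [measurable_cong] = P1_sets[OF P]
  have "norm (\<integral>A. (riem_dist Y A)\<^sup>2 - (riem_dist Z A)\<^sup>2 \<partial>\<nu>)
      \<le> (\<integral>A. norm ((riem_dist Y A)\<^sup>2 - (riem_dist Z A)\<^sup>2) \<partial>\<nu>)"
    by (rule integral_norm_bound)
  also have "\<dots> \<le> (\<integral>A. riem_dist Y Z * (2 * R + 2 * riem_dist (mat 1) A) \<partial>\<nu>)"
  proof (rule integral_mono_AE)
    show "integrable \<nu> (\<lambda>A. norm ((riem_dist Y A)\<^sup>2 - (riem_dist Z A)\<^sup>2))"
      using P1_integrable_diff[OF P Y Z] by (rule integrable_norm)
    show "integrable \<nu> (\<lambda>A. riem_dist Y Z * (2 * R + 2 * riem_dist (mat 1) A))"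
      using P1_integrable_riem_dist[OF P posdef_one] by simp
  next
    show "AE A in \<nu>. norm ((riem_dist Y A)\<^sup>2 - (riem_dist Z A)\<^sup>2)
      \<le> riem_dist Y Z * (2 * R + 2 * riem_dist (mat 1) A)"
      using P1_AE_posdef[OF P]
    proof eventually_elim
      case (elim A)
      have "riem_dist Y A + riem_dist Z A \<le> 2 * R + 2 * riem_dist (mat 1) A"
        using riem_dist_triangle[OF Y posdef_one elim] riem_dist_triangle[OF Z posdef_one elim] r
          riem_dist_commute[OF Y posdef_one] riem_dist_commute[OF Z posdef_one] by simp
      then have "riem_dist Y Z * (riem_dist Y A + riem_dist Z A) \<le> riem_dist Y Z * (2 * R + 2 * riem_dist (mat 1) A)"
        by (rule mult_left_mono) simp
      then show ?case using riem_dist_power2_diff_le[OF Y Z elim] by simp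
    qed
  qed
  also have "\<dots> = riem_dist Y Z * (2 * R + 2 * (\<integral>A. riem_dist (mat 1) A \<partial>\<nu>))"
    using P1_integrable_riem_dist[OF P posdef_one] by (simp add: prob_space)
  finally show ?thesis by (simp add: cartan_objective_diff[OF P Y Z])
qed

text \<open>Coercivity: integrate the square of the reverse triangle inequality. The lower bound
  grows quadratically in the distance of \<open>Z\<close> from the identity.\<close>

lemma cartan_objective_ge:
  assumes P: "\<nu> \<in> P1" and Z: "posdef Z"
  shows "(riem_dist (mat 1) Z)\<^sup>2 - 2 * riem_dist (mat 1) Z * (\<integral>A. riem_dist (mat 1) A \<partial>\<nu>)
    \<le> cartan_objective \<nu> Z"
proof -
  interpret prob_space \<nu> using P by (rule P1_prob_space)
  note int = P1_integrable_riem_dist[OF P posdef_one]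
  let ?D = "riem_dist (mat 1) Z"
  have "(\<integral>A. ?D\<^sup>2 - 2 * ?D * riem_dist (mat 1) A \<partial>\<nu>) \<le> cartan_objective \<nu> Z"
    unfolding cartan_objective_def
  proof (rule integral_mono_AE)
    show "integrable \<nu> (\<lambda>A. ?D\<^sup>2 - 2 * ?D * riem_dist (mat 1) A)" using int by simp
    show "integrable \<nu> (\<lambda>A. (riem_dist Z A)\<^sup>2 - (riem_dist (mat 1) A)\<^sup>2)"
      using P1_integrable_diff[OF P Z posdef_one] .
    show "AE A in \<nu>. ?D\<^sup>2 - 2 * ?D * riem_dist (mat 1) A \<le> (riem_dist Z A)\<^sup>2 - (riem_dist (mat 1) A)\<^sup>2"
      using P1_AE_posdef[OF P]
    proof eventually_elim
      case (elim A)
      have "\<bar>?D - riem_dist (mat 1) A\<bar> \<le> \<bar>riem_dist Z A\<bar>"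
        using riem_dist_triangle3[OF Z elim posdef_one] riem_dist_commute[OF Z posdef_one]
          riem_dist_commute[OF elim posdef_one] by simp
      then have "(?D - riem_dist (mat 1) A)\<^sup>2 \<le> (riem_dist Z A)\<^sup>2" by (simp only: abs_le_square_iff)
      then show ?case by (simp add: power2_eq_square algebra_simps)
    qed
  qed
  then show ?thesis using int by (simp add: prob_space)
qed

lemma cartan_objective_minimizer:
  fixes \<nu> :: "(complex^'m^'m) measure"
  assumes P: "\<nu> \<in> P1"
  obtains Z where "posdef Z" "\<And>W. posdef W \<Longrightarrow> cartan_objective \<nu> Z \<le> cartan_objective \<nu> W"
proof -
  define m1 where "m1 = (\<integral>A. riem_dist (mat 1) A \<partial>\<nu>)"
  have m1: "m1 \<ge> 0" unfolding m1_def by (rule integral_nonneg_AE) simp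
  \<comment> \<open>Outside radius \<open>2 * m1\<close> the coercive bound is nonnegative, while
    the objective vanishes at the identity. Passing to logarithms makes the remaining ball
    compact.\<close>
  define K where "K = {H :: complex^'m^'m. hermitian_mat H} \<inter> cball 0 (2 * m1)"
  have K: "compact K" unfolding K_def by (intro closed_Int_compact closed_hermitian compact_cball)
  have 0: "0 \<in> K" using m1 by (simp add: K_def)
  define \<phi> where "\<phi> = (\<lambda>H. cartan_objective \<nu> (mexp H))"
  have "continuous_on K \<phi>"
  proof (rule lipschitz_on_continuous_on)
    show "(exp (2 * m1) * (2 * (2 * m1) + 2 * m1))-lipschitz_on K \<phi>"
    proof (rule lipschitz_onI)
      show "0 \<le> exp (2 * m1) * (2 * (2 * m1) + 2 * m1)" using m1 by simp
      fix H H' assume H: "H \<in> K" "H' \<in> K"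
      then have "\<bar>\<phi> H - \<phi> H'\<bar> \<le> riem_dist (mexp H) (mexp H') * (2 * (2 * m1) + 2 * m1)"
        unfolding \<phi>_def m1_def
        by (intro cartan_objective_lipschitz P) (simp_all add: K_def riem_dist_one m1_def)
      also have "\<dots> \<le> exp (2 * m1) * norm (H - H') * (2 * (2 * m1) + 2 * m1)"
        using H m1 by (intro mult_right_mono riem_dist_mexp_le) (auto simp: K_def)
      finally show "dist (\<phi> H) (\<phi> H') \<le> exp (2 * m1) * (2 * (2 * m1) + 2 * m1) * dist H H'"
        by (simp add: dist_norm mult_ac)
    qed
  qed
  then obtain H where H: "H \<in> K" "\<And>H'. H' \<in> K \<Longrightarrow> \<phi> H \<le> \<phi> H'"
    using continuous_attains_inf[OF K] 0 by blast
  have "cartan_objective \<nu> (mexp H) \<le> cartan_objective \<nu> W" if W: "posdef W" for W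
  proof (cases "norm (pd_log W) \<le> 2 * m1")
    case True
    then have "\<phi> H \<le> \<phi> (pd_log W)" by (intro H) (simp add: K_def)
    then show ?thesis using W by (simp add: \<phi>_def)
  next
    case False
    let ?D = "riem_dist (mat 1) W"
    have D: "?D > 2 * m1" using False W by (simp add: riem_dist_one)
    have "\<phi> H \<le> \<phi> 0" using H 0 by blast
    also have "\<dots> = 0" by (simp add: \<phi>_def cartan_objective_one)
    also have "0 \<le> ?D * (?D - 2 * m1)" using D m1 by simp
    also have "\<dots> \<le> cartan_objective \<nu> W"
      using cartan_objective_ge[OF P W] by (simp add: m1_def power2_eq_square algebra_simps)
    finally show ?thesis by (simp add: \<phi>_def)
  qed
  moreover have "posdef (mexp H)" using H by (simp add: K_def)
  ultimately show ?thesis using that by blast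
qed

text \<open>Compare the minimiser with the point at parameter \<open>s\<close> on the geodesic
  towards \<open>Z\<close>: integrate the semiparallelogram law, divide by \<open>s\<close> and let
  \<open>s\<close> tend to 0.\<close>

lemma cartan_variance_inequality:
  assumes P: "\<nu> \<in> P1" and z: "posdef z" and Z: "posdef Z"
    and min: "\<And>W. posdef W \<Longrightarrow> cartan_objective \<nu> z \<le> cartan_objective \<nu> W"
  shows "(riem_dist z Z)\<^sup>2 \<le> cartan_objective \<nu> Z - cartan_objective \<nu> z"
\<comment> \<open>It is enough to prove the bound with a factor \<open>r = 1 - s\<close> below 1,
  which replaces the limit.\<close>
proof (rule field_le_mult_one_interval)
  fix r :: real assume r: "0 < r" "r < 1"
  interpret prob_space \<nu> using P by (rule P1_prob_space)
  define s where "s = 1 - r"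
  obtain M where M: "posdef M" "\<And>A. posdef A \<Longrightarrow> (riem_dist A M)\<^sup>2
    \<le> (1 - s) * (riem_dist A z)\<^sup>2 + s * (riem_dist A Z)\<^sup>2 - s * (1 - s) * (riem_dist z Z)\<^sup>2"
    using riem_dist_semiparallelogram[OF z Z, of s] r by (auto simp: s_def)
  have iM: "integrable \<nu> (\<lambda>A. (riem_dist M A)\<^sup>2 - (riem_dist z A)\<^sup>2)"
    and iZ: "integrable \<nu> (\<lambda>A. (riem_dist Z A)\<^sup>2 - (riem_dist z A)\<^sup>2)"
    using P1_integrable_diff[OF P] M Z z by auto
  have "0 \<le> cartan_objective \<nu> M - cartan_objective \<nu> z" using min M by simp
  also have "\<dots> = (\<integral>A. (riem_dist M A)\<^sup>2 - (riem_dist z A)\<^sup>2 \<partial>\<nu>)"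
    by (rule cartan_objective_diff[OF P M(1) z])
  also have "\<dots> \<le> (\<integral>A. s * ((riem_dist Z A)\<^sup>2 - (riem_dist z A)\<^sup>2) - s * (1 - s) * (riem_dist z Z)\<^sup>2 \<partial>\<nu>)"
  proof (rule integral_mono_AE[OF iM])
    show "integrable \<nu> (\<lambda>A. s * ((riem_dist Z A)\<^sup>2 - (riem_dist z A)\<^sup>2) - s * (1 - s) * (riem_dist z Z)\<^sup>2)"
      by (rule Bochner_Integration.integrable_diff, rule integrable_mult_right, rule iZ) simp
    show "AE A in \<nu>. (riem_dist M A)\<^sup>2 - (riem_dist z A)\<^sup>2
        \<le> s * ((riem_dist Z A)\<^sup>2 - (riem_dist z A)\<^sup>2) - s * (1 - s) * (riem_dist z Z)\<^sup>2"
      using P1_AE_posdef[OF P]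
    proof eventually_elim
      case (elim A)
      then show ?case
        using M(2)[OF elim] M(1) z Z
        by (simp add: riem_dist_commute[of A] algebra_simps)
    qed
  qed
  also have "\<dots> = s * (cartan_objective \<nu> Z - cartan_objective \<nu> z) - s * (1 - s) * (riem_dist z Z)\<^sup>2"
  proof -
    have "(\<integral>A. s * g A - c \<partial>\<nu>) = s * (\<integral>A. g A \<partial>\<nu>) - c" if "integrable \<nu> g" for g c
      using that by (simp add: prob_space)
    from this[OF iZ] show ?thesis by (simp add: cartan_objective_diff[OF P Z z])
  qed
  finally have "s * ((1 - s) * (riem_dist z Z)\<^sup>2) \<le> s * (cartan_objective \<nu> Z - cartan_objective \<nu> z)"
    by simp
  then show "r * (riem_dist z Z)\<^sup>2 \<le> cartan_objective \<nu> Z - cartan_objective \<nu> z"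
    using r by (simp add: s_def)
qed

text \<open>Existence comes from compactness and uniqueness from the variance inequality between two
  minimisers, so the definite description in \<open>cartan_bary\<close> denotes.\<close>

lemma
  assumes P: "\<nu> \<in> P1"
  shows posdef_cartan_bary: "posdef (cartan_bary \<nu>)"
    and cartan_bary_le: "posdef W \<Longrightarrow> cartan_objective \<nu> (cartan_bary \<nu>) \<le> cartan_objective \<nu> W"
proof -
  let ?Q = "\<lambda>Z. posdef Z \<and> (\<forall>W. posdef W \<longrightarrow> cartan_objective \<nu> Z \<le> cartan_objective \<nu> W)"
  obtain z where z: "?Q z" using cartan_objective_minimizer[OF P] by metis
  have "Z = z" if Z: "?Q Z" for Z
  proof -
    have "(riem_dist z Z)\<^sup>2 \<le> cartan_objective \<nu> Z - cartan_objective \<nu> z"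
      using z Z by (intro cartan_variance_inequality[OF P]) auto
    also have "\<dots> \<le> 0" using z Z by simp
    finally show ?thesis using riem_dist_eq_0_imp_eq z Z by (metis power2_less_eq_zero_iff)
  qed
  then have "?Q (THE Z. ?Q Z)" using z by (intro theI[of ?Q]) auto
  then have "?Q (cartan_bary \<nu>)" by (simp add: cartan_bary_def cartan_objective_def)
  then show "posdef (cartan_bary \<nu>)"
    "posdef W \<Longrightarrow> cartan_objective \<nu> (cartan_bary \<nu>) \<le> cartan_objective \<nu> W" by auto
qed

section \<open>The barycenter along geodesics\<close>

text \<open>The metric is Euclidean to first order at the identity. The quotient is squeezed between
  the metric increasing property below and \<open>sdiv\<close> above, where
  \<open>sinh (x * t) / t\<close> tends to \<open>x\<close>.\<close>

lemma riem_dist_mexp_scaleR_tendsto: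
  assumes H: "hermitian_mat H" and L: "hermitian_mat L"
  shows "((\<lambda>t. (riem_dist (mexp (t *\<^sub>R H)) (mexp (t *\<^sub>R L)))\<^sup>2 / t\<^sup>2) \<longlongrightarrow> (norm (H - L))\<^sup>2) (at 0)"
proof -
  obtain U h V k where U: "unitary_mat U" "H = spec U h" and V: "unitary_mat V" "L = spec V k"
    using H L by (metis hermitian_spectral)
  let ?u = "\<lambda>t. \<Sum>i\<in>UNIV. \<Sum>j\<in>UNIV. transition U V i j * (2 * (sinh ((h i - k j) / 2 * t) / t))\<^sup>2"
  let ?d = "\<lambda>t. riem_dist (mexp (t *\<^sub>R H)) (mexp (t *\<^sub>R L))"
  show ?thesis
  proof (rule tendsto_sandwich)
    show "\<forall>\<^sub>F t in at 0. (norm (H - L))\<^sup>2 \<le> (?d t)\<^sup>2 / t\<^sup>2"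
      using eventually_neq_at_within[of 0]
    proof eventually_elim
      case (elim t)
      have "norm (t *\<^sub>R H - t *\<^sub>R L) \<le> ?d t"
        using norm_pd_log_diff_le_riem_dist[of "mexp (t *\<^sub>R H)" "mexp (t *\<^sub>R L)"] H L by simp
      then have "\<bar>t\<bar> * norm (H - L) \<le> ?d t" by (simp flip: scaleR_diff_right)
      then have "(\<bar>t\<bar> * norm (H - L))\<^sup>2 \<le> (?d t)\<^sup>2" by (rule power_mono) simp
      then show ?case using elim by (simp add: power_mult_distrib field_simps)
    qed
    show "\<forall>\<^sub>F t in at 0. (?d t)\<^sup>2 / t\<^sup>2 \<le> ?u t"
      using eventually_neq_at_within[of 0]
    proof eventually_elim
      case (elim t)
      have "(?d t)\<^sup>2 \<le> sdiv (mexp (t *\<^sub>R H)) (mexp (t *\<^sub>R L))"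
        using H L by (intro riem_dist_le_sdiv) auto
      also have "\<dots> = (\<Sum>i\<in>UNIV. \<Sum>j\<in>UNIV. transition U V i j * (2 * sinh ((h i - k j) / 2 * t))\<^sup>2)"
        unfolding U(2) V(2) scaleR_spec sdiv_mexp_spec[OF U(1) V(1)]
        by (simp add: algebra_simps diff_divide_distrib)
      finally have "(?d t)\<^sup>2 / t\<^sup>2 \<le> \<dots> / t\<^sup>2" by (rule divide_right_mono) simp
      also have "\<dots> = ?u t" by (simp add: sum_divide_distrib power_mult_distrib power_divide)
      finally show ?case .
    qed
    show "((\<lambda>t. (norm (H - L))\<^sup>2) \<longlongrightarrow> (norm (H - L))\<^sup>2) (at 0)" by simp
    have "(?u \<longlongrightarrow> (\<Sum>i\<in>UNIV. \<Sum>j\<in>UNIV. transition U V i j * (2 * ((h i - k j) / 2))\<^sup>2)) (at 0)"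
      by (intro tendsto_intros sinh_scaled_tendsto)
    then show "(?u \<longlongrightarrow> (norm (H - L))\<^sup>2) (at 0)"
      by (simp only: U(2) V(2) norm_spec_diff[OF U(1) V(1)] mult_2 field_sum_of_halves)
  qed
qed

section \<open>Quadratic remainder of the exponential\<close>

lemma exp_minus_one_minus_le:
  fixes x :: real
  assumes "\<bar>x\<bar> \<le> 1"
  shows "\<bar>exp x - 1 - x\<bar> \<le> x\<^sup>2"
proof -
  have "exp x \<le> 1 + x + x\<^sup>2"
  proof (cases "0 \<le> x")
    case True
    then show ?thesis using assms exp_bound[of x] by simp
  next
    case False
    \<comment> \<open>For negative \<open>x\<close> the estimate is multiplied by the positive
      factor \<open>1 - x\<close>, which turns the right-hand side into
      \<open>1 - x ^ 3\<close>.\<close>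
    have "exp x * (1 - x) \<le> exp x * exp (- x)"
      using exp_ge_add_one_self[of "- x"] by (intro mult_left_mono) auto
    also have "\<dots> = 1" by (simp flip: exp_add)
    also have "1 \<le> 1 - x ^ 3" using False by (simp add: power_le_zero_eq)
    also have "\<dots> = (1 + x + x\<^sup>2) * (1 - x)" by (simp add: algebra_simps power2_eq_square power3_eq_cube)
    finally show ?thesis using False by simp
  qed
  then show ?thesis using exp_ge_add_one_self[of x] by linarith
qed

lemma spec_diff: "spec U d - spec U e = spec U (\<lambda>i. d i - e i)"
proof -
  have "diag_mat (\<lambda>i. complex_of_real (d i - e i))
      = diag_mat (\<lambda>i. complex_of_real (d i)) - diag_mat (\<lambda>i. complex_of_real (e i))"
    by (simp add: diag_mat_def vec_eq_iff)
  then show ?thesis by (simp only: spec_def matmul.diff_left matmul.diff_right)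
qed

lemma norm_mexp_minus_one_minus_le:
  assumes "hermitian_mat M" "norm M \<le> 1"
  shows "norm (mexp M - mat 1 - M) \<le> (norm M)\<^sup>2"
proof -
  obtain U d where U: "unitary_mat U" "M = spec U d" using assms(1) by (rule hermitian_spectral)
  have d: "\<bar>d i\<bar> \<le> norm M" for i using abs_le_norm_spec[OF U(1), of d] U by simp
  have "(norm (mexp M - mat 1 - M))\<^sup>2 = (\<Sum>i\<in>UNIV. (exp (d i) - 1 - d i)\<^sup>2)"
    unfolding U(2) mexp_spec[OF U(1)] spec_one[OF U(1), symmetric] spec_diff norm_spec[OF U(1)] ..
  also have "\<dots> \<le> (\<Sum>i\<in>UNIV. (norm M)\<^sup>2 * (d i)\<^sup>2)"
  proof (rule sum_mono)
    fix i
    have "\<bar>exp (d i) - 1 - d i\<bar> \<le> (d i)\<^sup>2"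
      using d[of i] assms(2) by (intro exp_minus_one_minus_le) simp
    then have "\<bar>exp (d i) - 1 - d i\<bar>\<^sup>2 \<le> ((d i)\<^sup>2)\<^sup>2" by (rule power_mono) simp
    also have "\<dots> = \<bar>d i\<bar>\<^sup>2 * (d i)\<^sup>2" by (simp add: power2_eq_square)
    also have "\<dots> \<le> (norm M)\<^sup>2 * (d i)\<^sup>2" using d by (intro mult_right_mono power_mono) auto
    finally show "(exp (d i) - 1 - d i)\<^sup>2 \<le> (norm M)\<^sup>2 * (d i)\<^sup>2" by simp
  qed
  also have "\<dots> = ((norm M)\<^sup>2)\<^sup>2"
    using norm_spec[OF U(1), of d] by (simp add: U(2) power2_eq_square flip: sum_distrib_left)
  finally show ?thesis by (rule power2_le_imp_le) simp
qed

lemma bounded_linear_congr: "bounded_linear (congr C)"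
  unfolding congr_def
  by (intro bounded_linear_compose[OF matmul.bounded_linear_left matmul.bounded_linear_right])

lemma bounded_linear_adjoint_mat: "bounded_linear adjoint_mat"
  unfolding linear_conv_bounded_linear[symmetric] adjoint_mat_def
  by (intro linearI) (simp_all add: vec_eq_iff)

text \<open>The Riemannian logarithm of \<open>A\<close> at base point \<open>X\<close>, transported
  to the identity. In this chart the geodesics from \<open>X\<close> are the rays
  \<open>t *\<^sub>R pd_log_at X A\<close>.\<close>

definition pd_log_at :: "complex^'m^'m \<Rightarrow> complex^'m^'m \<Rightarrow> complex^'m^'m" where
  "pd_log_at X A = pd_log (congr (pd_pow (-1/2) X) A)"

lemma hermitian_pd_log_at [simp]: "hermitian_mat (pd_log_at X A)"
  by (simp add: pd_log_at_def)

lemma norm_pd_log_at: "posdef X \<Longrightarrow> posdef A \<Longrightarrow> norm (pd_log_at X A) = riem_dist X A"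
  by (simp only: pd_log_at_def riem_dist_eq)

lemma congr_mexp_pd_log_at:
  assumes "posdef X" "posdef A"
  shows "congr (pd_pow (1/2) X) (mexp (pd_log_at X A)) = A"
  using congr_pd_pow_inverse[OF assms(1), of "1/2" A] assms by (simp add: pd_log_at_def)

lemma geo_eq:
  assumes "posdef X" "posdef A"
  shows "geo t X A = congr (pd_pow (1/2) X) (mexp (t *\<^sub>R pd_log_at X A))"
  using assms posdef_normalize[OF assms, of "-1/2"]
  by (simp add: geo_def congr_def pd_log_at_def pd_pow_eq_mexp[of "pd_pow _ X ** A ** pd_pow _ X"])

lemma posdef_geo [simp]: "posdef X \<Longrightarrow> posdef A \<Longrightarrow> posdef (geo t X A)"
  by (simp add: geo_eq posdef_congr)

lemma geo_zero: "posdef X \<Longrightarrow> posdef A \<Longrightarrow> geo 0 X A = X"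
  by (simp add: geo_eq congr_def pd_pow_mult)

lemma riem_dist_geo:
  assumes "posdef X" "posdef A"
  shows "riem_dist (geo s X A) (geo t X A) = \<bar>s - t\<bar> * riem_dist X A"
  using assms by (simp add: geo_eq riem_dist_congr riem_dist_mexp_scaleR norm_pd_log_at)

lemma riem_dist_geo_left: "posdef X \<Longrightarrow> posdef A \<Longrightarrow> riem_dist X (geo t X A) = \<bar>t\<bar> * riem_dist X A"
  using riem_dist_geo[of X A 0 t] by (simp add: geo_zero)

lemma borel_measurable_pd_log_at [measurable]: "pd_log_at X \<in> borel_measurable borel"
  unfolding pd_log_at_def[abs_def] by measurable

lemma borel_measurable_geo [measurable]:
  assumes "posdef X" shows "geo t X \<in> borel_measurable borel"
proof -
  have [measurable]: "(\<lambda>A. mexp (t *\<^sub>R pd_log_at X A)) \<in> borel_measurable borel"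
    by (rule borel_measurable_mexp) auto
  have "geo t X = (\<lambda>A. if posdef A then congr (pd_pow (1/2) X) (mexp (t *\<^sub>R pd_log_at X A)) else 0)"
    using assms by (intro ext) (simp add: geo_eq, simp add: geo_def)
  then show ?thesis by simp
qed

section \<open>Barycenters of the push-forwards along geodesics from a base point\<close>

context
  fixes X :: "complex^'m^'m" and \<mu> :: "(complex^'m^'m) measure"
  assumes X: "posdef X" and P: "\<mu> \<in> P1"
begin

interpretation prob_space \<mu> using P by (rule P1_prob_space)

declare P1_sets[OF P, measurable_cong]
declare borel_measurable_geo[OF X, measurable]

lemma integrable_pd_log_at: "integrable \<mu> (pd_log_at X)"
proof (rule Bochner_Integration.integrable_bound)
  show "integrable \<mu> (riem_dist X)" by (rule P1_integrable_riem_dist[OF P X])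
  show "pd_log_at X \<in> borel_measurable \<mu>" by measurable
  show "AE A in \<mu>. norm (pd_log_at X A) \<le> norm (riem_dist X A)"
    using P1_AE_posdef[OF P] by eventually_elim (simp add: norm_pd_log_at X)
qed

text \<open>The distance from \<open>X\<close> is scaled by \<open>\<bar>t\<bar>\<close> under
  \<open>geo t X\<close>, so the first moment based at \<open>X\<close> stays finite.\<close>

lemma geo_push_P1: "geo_push X t \<mu> \<in> P1"
proof -
  have "prob_space (geo_push X t \<mu>)"
    unfolding geo_push_def by (rule prob_space_distr) measurable
  moreover have "sets (geo_push X t \<mu>) = sets borel" by (simp add: geo_push_def)
  moreover have "AE A in geo_push X t \<mu>. posdef A"
    unfolding geo_push_def using P1_AE_posdef[OF P] by (subst AE_distr_iff) (auto simp: X)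
  moreover have "integrable (geo_push X t \<mu>) (\<lambda>Z. riem_dist Z X)"
  proof -
    have "integrable \<mu> (\<lambda>A. riem_dist X (geo t X A))"
    proof (rule Bochner_Integration.integrable_bound)
      show "integrable \<mu> (\<lambda>A. \<bar>t\<bar> * riem_dist X A)" using P1_integrable_riem_dist[OF P X] by simp
      show "(\<lambda>A. riem_dist X (geo t X A)) \<in> borel_measurable \<mu>" by measurable
      show "AE A in \<mu>. norm (riem_dist X (geo t X A)) \<le> norm (\<bar>t\<bar> * riem_dist X A)"
        using P1_AE_posdef[OF P] by eventually_elim (simp add: X riem_dist_geo_left)
    qed
    then have "integrable (geo_push X t \<mu>) (riem_dist X)"
      unfolding geo_push_def by (subst integrable_distr_eq) auto
    moreover have "riem_dist Z X = riem_dist X Z" for Z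
      using riem_dist_commute[OF _ X, of Z] by (cases "posdef Z") (auto simp: riem_dist_def)
    ultimately show ?thesis by simp
  qed
  ultimately show ?thesis using X by (auto simp: P1_def)
qed

lemma cartan_objective_geo_push_diff:
  assumes "posdef Y" "posdef Z"
  shows "integrable \<mu> (\<lambda>A. (riem_dist Y (geo t X A))\<^sup>2 - (riem_dist Z (geo t X A))\<^sup>2)"
    and "cartan_objective (geo_push X t \<mu>) Y - cartan_objective (geo_push X t \<mu>) Z
      = (\<integral>A. (riem_dist Y (geo t X A))\<^sup>2 - (riem_dist Z (geo t X A))\<^sup>2 \<partial>\<mu>)"
proof -
  show "integrable \<mu> (\<lambda>A. (riem_dist Y (geo t X A))\<^sup>2 - (riem_dist Z (geo t X A))\<^sup>2)"
    using P1_integrable_diff[OF geo_push_P1 assms] unfolding geo_push_def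
    by (subst (asm) integrable_distr_eq) auto
  show "cartan_objective (geo_push X t \<mu>) Y - cartan_objective (geo_push X t \<mu>) Z
      = (\<integral>A. (riem_dist Y (geo t X A))\<^sup>2 - (riem_dist Z (geo t X A))\<^sup>2 \<partial>\<mu>)"
    unfolding cartan_objective_diff[OF geo_push_P1 assms] unfolding geo_push_def
    by (rule integral_distr) auto
qed

text \<open>Add the variance inequalities of the two barycenters, each tested at the other. The
  quadruple inequality bounds the combined integrand by \<open>2 * D\<close> times the distance
  \<open>\<bar>s - t\<bar> * riem_dist X A\<close> between the two images of \<open>A\<close>; one
  factor \<open>D\<close> then cancels.\<close>

lemma cartan_bary_geo_push_lipschitz:
  "riem_dist (cartan_bary (geo_push X s \<mu>)) (cartan_bary (geo_push X t \<mu>))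
    \<le> (\<integral>A. riem_dist X A \<partial>\<mu>) * \<bar>s - t\<bar>"
proof -
  define y z where "y = cartan_bary (geo_push X s \<mu>)" and "z = cartan_bary (geo_push X t \<mu>)"
  have y: "posdef y" and z: "posdef z"
    unfolding y_def z_def by (intro posdef_cartan_bary geo_push_P1)+
  define D where "D = riem_dist y z"
  have D: "D \<ge> 0" by (simp add: D_def)
  note int = cartan_objective_geo_push_diff
  have "D\<^sup>2 \<le> cartan_objective (geo_push X s \<mu>) z - cartan_objective (geo_push X s \<mu>) y"
    unfolding D_def using cartan_bary_le[OF geo_push_P1[of s]]
    by (intro cartan_variance_inequality geo_push_P1 y z) (simp add: y_def)
  moreover have "D\<^sup>2 \<le> cartan_objective (geo_push X t \<mu>) y - cartan_objective (geo_push X t \<mu>) z"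
    unfolding D_def riem_dist_commute[OF y z] using cartan_bary_le[OF geo_push_P1[of t]]
    by (intro cartan_variance_inequality geo_push_P1 y z) (simp add: z_def)
  ultimately have "2 * D\<^sup>2 \<le> (\<integral>A. (riem_dist z (geo s X A))\<^sup>2 - (riem_dist y (geo s X A))\<^sup>2 \<partial>\<mu>)
      + (\<integral>A. (riem_dist y (geo t X A))\<^sup>2 - (riem_dist z (geo t X A))\<^sup>2 \<partial>\<mu>)"
    unfolding int(2)[OF y z] int(2)[OF z y] by simp
  also have "\<dots> = (\<integral>A. ((riem_dist z (geo s X A))\<^sup>2 - (riem_dist y (geo s X A))\<^sup>2)
      + ((riem_dist y (geo t X A))\<^sup>2 - (riem_dist z (geo t X A))\<^sup>2) \<partial>\<mu>)"
    by (rule Bochner_Integration.integral_add[symmetric]) (intro int y z)+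
  also have "\<dots> \<le> (\<integral>A. 2 * D * \<bar>s - t\<bar> * riem_dist X A \<partial>\<mu>)"
  proof (rule integral_mono_AE)
    show "integrable \<mu> (\<lambda>A. ((riem_dist z (geo s X A))\<^sup>2 - (riem_dist y (geo s X A))\<^sup>2)
      + ((riem_dist y (geo t X A))\<^sup>2 - (riem_dist z (geo t X A))\<^sup>2))"
      by (rule Bochner_Integration.integrable_add) (intro int y z)+
    show "integrable \<mu> (\<lambda>A. 2 * D * \<bar>s - t\<bar> * riem_dist X A)"
      using P1_integrable_riem_dist[OF P X] by simp
    show "AE A in \<mu>. ((riem_dist z (geo s X A))\<^sup>2 - (riem_dist y (geo s X A))\<^sup>2)
      + ((riem_dist y (geo t X A))\<^sup>2 - (riem_dist z (geo t X A))\<^sup>2) \<le> 2 * D * \<bar>s - t\<bar> * riem_dist X A"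
      using P1_AE_posdef[OF P]
    proof eventually_elim
      case (elim A)
      then have "posdef (geo s X A)" "posdef (geo t X A)" using X by simp_all
      from riem_dist_quadruple[OF z y this] show ?case
        using riem_dist_geo[OF X elim, of s t] riem_dist_commute[OF y z] by (simp add: D_def mult_ac)
    qed
  qed
  also have "\<dots> = 2 * D * \<bar>s - t\<bar> * (\<integral>A. riem_dist X A \<partial>\<mu>)"
    by simp
  finally have *: "D * D \<le> D * ((\<integral>A. riem_dist X A \<partial>\<mu>) * \<bar>s - t\<bar>)"
    by (simp add: power2_eq_square mult_ac)
  have "D \<le> (\<integral>A. riem_dist X A \<partial>\<mu>) * \<bar>s - t\<bar>"
  proof (cases "D = 0")
    case True
    then show ?thesis by (simp add: integral_nonneg_AE)
  next
    case False
    then show ?thesis using * D by (simp add: mult_le_cancel_left)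
  qed
  then show ?thesis by (simp add: D_def y_def z_def)
qed

lemma hermitian_integral_pd_log_at: "hermitian_mat (\<integral>A. pd_log_at X A \<partial>\<mu>)"
proof -
  have "adjoint_mat (\<integral>A. pd_log_at X A \<partial>\<mu>) = (\<integral>A. adjoint_mat (pd_log_at X A) \<partial>\<mu>)"
    by (rule integral_bounded_linear[OF bounded_linear_adjoint_mat integrable_pd_log_at, symmetric])
  also have "\<dots> = (\<integral>A. pd_log_at X A \<partial>\<mu>)"
    using hermitian_pd_log_at[of X] unfolding hermitian_mat_def by simp
  finally show ?thesis by (simp add: hermitian_mat_def)
qed

text \<open>For \<open>t = 0\<close> almost every \<open>A\<close> is sent to \<open>X\<close>, so
  no point has a smaller objective than \<open>X\<close>, and the variance inequality identifies the
  minimiser.\<close>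

lemma cartan_bary_geo_push_zero: "cartan_bary (geo_push X 0 \<mu>) = X"
proof -
  let ?z = "cartan_bary (geo_push X 0 \<mu>)"
  have z: "posdef ?z" by (intro posdef_cartan_bary geo_push_P1)
  have "(riem_dist ?z X)\<^sup>2 \<le> cartan_objective (geo_push X 0 \<mu>) X - cartan_objective (geo_push X 0 \<mu>) ?z"
    using cartan_bary_le[OF geo_push_P1] by (intro cartan_variance_inequality geo_push_P1 z X)
  also have "\<dots> = (\<integral>A. (riem_dist X (geo 0 X A))\<^sup>2 - (riem_dist ?z (geo 0 X A))\<^sup>2 \<partial>\<mu>)"
    by (rule cartan_objective_geo_push_diff(2)[OF X z])
  also have "\<dots> \<le> (\<integral>A. 0 \<partial>\<mu>)"
  proof (rule integral_mono_AE)
    show "AE A in \<mu>. (riem_dist X (geo 0 X A))\<^sup>2 - (riem_dist ?z (geo 0 X A))\<^sup>2 \<le> 0"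
      using P1_AE_posdef[OF P] by eventually_elim (simp add: geo_zero X)
  qed (simp_all add: cartan_objective_geo_push_diff(1) X z)
  finally have "riem_dist ?z X = 0" by simp
  then show ?thesis by (rule riem_dist_eq_0_imp_eq[OF z X])
qed

text \<open>Measure the objective relative to \<open>X\<close>. At the barycenter it is at least
  \<open>(norm K)\<^sup>2 - 2 * t * (K \<bullet> H)\<close> by the metric increasing property; by
  minimality it is at most its value \<open>t\<^sup>2 * \<psi> t\<close> at the competitor
  \<open>W t\<close>. Completing the square leaves the excess of \<open>\<psi> t\<close> over its
  limit.\<close>

lemma cartan_bary_geo_push_log_approx:
  defines "H \<equiv> \<integral>A. pd_log_at X A \<partial>\<mu>"
  obtains \<epsilon> where "(\<epsilon> \<longlongrightarrow> 0) (at 0)"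
    "\<And>t. t \<noteq> 0 \<Longrightarrow> norm (pd_log_at X (cartan_bary (geo_push X t \<mu>)) - t *\<^sub>R H) \<le> \<bar>t\<bar> * sqrt (\<epsilon> t)"
proof -
  let ?P = "pd_pow (1/2) X"
  let ?b = "\<lambda>t. cartan_bary (geo_push X t \<mu>)"
  have H: "hermitian_mat H" unfolding H_def by (rule hermitian_integral_pd_log_at)
  define W where "W = (\<lambda>t. congr ?P (mexp (t *\<^sub>R H)))"
  have W: "posdef (W t)" for t using H X by (simp add: W_def posdef_congr)
  have b: "posdef (?b t)" for t by (intro posdef_cartan_bary geo_push_P1)
  have dW: "riem_dist (W t) (geo t X A) = riem_dist (mexp (t *\<^sub>R H)) (mexp (t *\<^sub>R pd_log_at X A))"
    if "posdef A" for t A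
    using that X H by (simp add: W_def geo_eq riem_dist_congr)
  define g where "g = (\<lambda>t A. ((riem_dist (W t) (geo t X A))\<^sup>2 - (riem_dist X (geo t X A))\<^sup>2) / t\<^sup>2)"
  define \<psi> where "\<psi> = (\<lambda>t. \<integral>A. g t A \<partial>\<mu>)"
  have lim: "(\<psi> \<longlongrightarrow> - (norm H)\<^sup>2) (at 0)"
    \<comment> \<open>Dominated convergence is applied along sequences that tend to 0 and avoid
      0.\<close>
    unfolding tendsto_at_iff_sequentially comp_def
  proof (intro allI impI)
    fix \<tau> :: "nat \<Rightarrow> real"
    assume \<tau>: "\<forall>n. \<tau> n \<in> UNIV - {0}" "\<tau> \<longlonglongrightarrow> 0"
    then have \<tau>0: "\<tau> n \<noteq> 0" for n by blast
    have \<tau>at: "filterlim \<tau> (at 0) sequentially" using \<tau> by (auto intro!: filterlim_atI)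
    have "(\<lambda>n. \<integral>A. g (\<tau> n) A \<partial>\<mu>) \<longlonglongrightarrow> (\<integral>A. (norm (H - pd_log_at X A))\<^sup>2 - (norm (pd_log_at X A))\<^sup>2 \<partial>\<mu>)"
    proof (rule integral_dominated_convergence)
      show "(\<lambda>A. (norm (H - pd_log_at X A))\<^sup>2 - (norm (pd_log_at X A))\<^sup>2) \<in> borel_measurable \<mu>"
        by measurable
      show "g (\<tau> n) \<in> borel_measurable \<mu>" for n unfolding g_def by measurable
      show "integrable \<mu> (\<lambda>A. norm H * (norm H + 2 * riem_dist X A))"
        using P1_integrable_riem_dist[OF P X] by simp
      show "AE A in \<mu>. (\<lambda>n. g (\<tau> n) A) \<longlonglongrightarrow> (norm (H - pd_log_at X A))\<^sup>2 - (norm (pd_log_at X A))\<^sup>2"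
        using P1_AE_posdef[OF P]
      proof eventually_elim
        case (elim A)
        have eq: "g (\<tau> n) A = (riem_dist (mexp (\<tau> n *\<^sub>R H)) (mexp (\<tau> n *\<^sub>R pd_log_at X A)))\<^sup>2 / (\<tau> n)\<^sup>2
            - (norm (pd_log_at X A))\<^sup>2" for n
          using \<tau>0[of n] elim X unfolding g_def dW[OF elim]
          by (simp add: riem_dist_geo_left norm_pd_log_at power_mult_distrib diff_divide_distrib)
        show ?case unfolding eq
          by (intro tendsto_intros filterlim_compose[OF riem_dist_mexp_scaleR_tendsto \<tau>at] H)
            simp
      qed
      \<comment> \<open>Both \<open>W t\<close> and \<open>geo t X A\<close> stay within a multiple
        of \<open>\<bar>t\<bar>\<close> from \<open>X\<close>, so the difference of squares is of
        order \<open>t\<^sup>2\<close> and the bound no longer depends on \<open>t\<close>.\<close>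
      show "AE A in \<mu>. norm (g (\<tau> n) A) \<le> norm H * (norm H + 2 * riem_dist X A)" for n
        using P1_AE_posdef[OF P]
      proof eventually_elim
        case (elim A)
        let ?G = "geo (\<tau> n) X A" and ?t = "\<bar>\<tau> n\<bar>"
        have G: "posdef ?G" using elim X by simp
        have WX: "riem_dist (W (\<tau> n)) X = ?t * norm H"
        proof -
          have "X = congr ?P (mexp (0 *\<^sub>R H))" using X by (simp add: congr_def pd_pow_mult)
          then have "riem_dist (W (\<tau> n)) X = riem_dist (mexp (\<tau> n *\<^sub>R H)) (mexp (0 *\<^sub>R H))"
            using X H unfolding W_def by (metis invertible_pd_pow posdef_mexp riem_dist_congr hermitian_scaleR)
          then show ?thesis by (simp only: riem_dist_mexp_scaleR[OF H]) simp
        qed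
        have XG: "riem_dist X ?G = ?t * riem_dist X A" using X elim by (rule riem_dist_geo_left)
        have "\<bar>(riem_dist (W (\<tau> n)) ?G)\<^sup>2 - (riem_dist X ?G)\<^sup>2\<bar>
            \<le> riem_dist (W (\<tau> n)) X * (riem_dist (W (\<tau> n)) ?G + riem_dist X ?G)"
          by (rule riem_dist_power2_diff_le[OF W X G])
        also have "\<dots> \<le> riem_dist (W (\<tau> n)) X * (riem_dist (W (\<tau> n)) X + 2 * riem_dist X ?G)"
          using riem_dist_triangle[OF W X G, of "\<tau> n"] by (intro mult_left_mono) auto
        also have "\<dots> = (norm H * (norm H + 2 * riem_dist X A)) * ?t\<^sup>2"
          unfolding WX XG by (simp only: power2_eq_square) (simp add: algebra_simps)
        finally show ?case
          using \<tau>0[of n] by (simp add: g_def abs_divide divide_le_eq)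
      qed
    qed
    also have "(\<integral>A. (norm (H - pd_log_at X A))\<^sup>2 - (norm (pd_log_at X A))\<^sup>2 \<partial>\<mu>)
        = (\<integral>A. (norm H)\<^sup>2 - 2 * (H \<bullet> pd_log_at X A) \<partial>\<mu>)"
      by (simp add: power2_norm_eq_inner inner_diff inner_commute)
    \<comment> \<open>The inner product with \<open>H\<close> commutes with the integral, and
      \<open>H\<close> is the mean of the logarithms.\<close>
    also have "\<dots> = (norm H)\<^sup>2 - 2 * (H \<bullet> H)"
      using integrable_pd_log_at by (simp add: prob_space integrable_inner_right H_def)
    also have "\<dots> = - (norm H)\<^sup>2" by (simp add: power2_norm_eq_inner)
    finally show "(\<lambda>n. \<psi> (\<tau> n)) \<longlonglongrightarrow> - (norm H)\<^sup>2" by (simp add: \<psi>_def)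
  qed
  define \<epsilon> where "\<epsilon> = (\<lambda>t. \<psi> t + (norm H)\<^sup>2)"
  have "(\<epsilon> \<longlongrightarrow> 0) (at 0)" unfolding \<epsilon>_def using tendsto_add[OF lim tendsto_const[of "(norm H)\<^sup>2"]] by simp
  moreover have "norm (pd_log_at X (?b t) - t *\<^sub>R H) \<le> \<bar>t\<bar> * sqrt (\<epsilon> t)" if t: "t \<noteq> 0" for t
  proof -
    define K where "K = pd_log_at X (?b t)"
    have K: "hermitian_mat K" by (simp add: K_def)
    have iKL: "integrable \<mu> (\<lambda>A. K \<bullet> pd_log_at X A)"
      using integrable_pd_log_at by simp
    have "(norm K)\<^sup>2 - 2 * t * (K \<bullet> H) = (\<integral>A. (norm K)\<^sup>2 - 2 * t * (K \<bullet> pd_log_at X A) \<partial>\<mu>)"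
      using iKL integrable_pd_log_at by (simp add: prob_space H_def)
    also have "\<dots> \<le> (\<integral>A. (riem_dist (?b t) (geo t X A))\<^sup>2 - (riem_dist X (geo t X A))\<^sup>2 \<partial>\<mu>)"
    proof (rule integral_mono_AE)
      show "integrable \<mu> (\<lambda>A. (norm K)\<^sup>2 - 2 * t * (K \<bullet> pd_log_at X A))" using iKL by simp
      show "integrable \<mu> (\<lambda>A. (riem_dist (?b t) (geo t X A))\<^sup>2 - (riem_dist X (geo t X A))\<^sup>2)"
        by (rule cartan_objective_geo_push_diff(1)[OF b X])
      show "AE A in \<mu>. (norm K)\<^sup>2 - 2 * t * (K \<bullet> pd_log_at X A)
          \<le> (riem_dist (?b t) (geo t X A))\<^sup>2 - (riem_dist X (geo t X A))\<^sup>2"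
        using P1_AE_posdef[OF P]
      proof eventually_elim
        case (elim A)
        let ?L = "pd_log_at X A"
        have "riem_dist (?b t) (geo t X A) = riem_dist (congr ?P (mexp K)) (congr ?P (mexp (t *\<^sub>R ?L)))"
          using X b[of t] elim by (simp add: K_def congr_mexp_pd_log_at geo_eq)
        also have "\<dots> = riem_dist (mexp K) (mexp (t *\<^sub>R ?L))"
          using X K by (simp add: riem_dist_congr)
        finally have "norm (K - t *\<^sub>R ?L) \<le> riem_dist (?b t) (geo t X A)"
          using norm_pd_log_diff_le_riem_dist[of "mexp K" "mexp (t *\<^sub>R ?L)"] K by simp
        then have "(norm (K - t *\<^sub>R ?L))\<^sup>2 \<le> (riem_dist (?b t) (geo t X A))\<^sup>2"
          by (rule power_mono) simp
        moreover have "(riem_dist X (geo t X A))\<^sup>2 = t\<^sup>2 * (norm ?L)\<^sup>2"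
          using X elim by (simp add: riem_dist_geo_left norm_pd_log_at power_mult_distrib)
        moreover have "(norm (K - t *\<^sub>R ?L))\<^sup>2 = (norm K)\<^sup>2 - 2 * t * (K \<bullet> ?L) + t\<^sup>2 * (norm ?L)\<^sup>2"
          unfolding power2_norm_eq_inner by (simp add: inner_diff inner_commute power2_eq_square algebra_simps)
        ultimately show ?case by linarith
      qed
    qed
    also have "\<dots> = cartan_objective (geo_push X t \<mu>) (?b t) - cartan_objective (geo_push X t \<mu>) X"
      by (rule cartan_objective_geo_push_diff(2)[OF b X, symmetric])
    also have "\<dots> \<le> cartan_objective (geo_push X t \<mu>) (W t) - cartan_objective (geo_push X t \<mu>) X"
      using cartan_bary_le[OF geo_push_P1 W] by simp
    also have "\<dots> = (\<integral>A. (riem_dist (W t) (geo t X A))\<^sup>2 - (riem_dist X (geo t X A))\<^sup>2 \<partial>\<mu>)"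
      by (rule cartan_objective_geo_push_diff(2)[OF W X])
    also have "\<dots> = t\<^sup>2 * \<psi> t"
      using t by (simp add: \<psi>_def g_def)
    finally have "(norm K)\<^sup>2 - 2 * t * (K \<bullet> H) \<le> t\<^sup>2 * \<psi> t" .
    moreover have "(norm (K - t *\<^sub>R H))\<^sup>2 = (norm K)\<^sup>2 - 2 * t * (K \<bullet> H) + t\<^sup>2 * (norm H)\<^sup>2"
      unfolding power2_norm_eq_inner by (simp add: inner_diff inner_commute power2_eq_square algebra_simps)
    ultimately have "(norm (K - t *\<^sub>R H))\<^sup>2 \<le> t\<^sup>2 * \<epsilon> t" by (simp add: \<epsilon>_def algebra_simps)
    then have "norm (K - t *\<^sub>R H) \<le> sqrt (t\<^sup>2 * \<epsilon> t)" by (rule real_le_rsqrt)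
    then show ?thesis by (simp add: K_def real_sqrt_mult)
  qed
  ultimately show ?thesis by (rule that)
qed

text \<open>Split the error into the quadratic remainder of \<open>mexp\<close> at
  \<open>K t\<close> and the deviation of \<open>K t\<close> from \<open>t *\<^sub>R H\<close>. The
  Lipschitz bound makes the former of order \<open>t\<^sup>2\<close>; the latter is controlled by
  \<open>cartan_bary_geo_push_log_approx\<close>. The bounded linear map \<open>congr\<close>
  carries both over.\<close>

lemma cartan_bary_geo_push_has_vector_derivative:
  "((\<lambda>t. cartan_bary (geo_push X t \<mu>)) has_vector_derivative
    congr (pd_pow (1/2) X) (\<integral>A. pd_log_at X A \<partial>\<mu>)) (at 0)"
proof -
  let ?P = "pd_pow (1/2) X"
  let ?b = "\<lambda>t. cartan_bary (geo_push X t \<mu>)"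
  define H where "H = (\<integral>A. pd_log_at X A \<partial>\<mu>)"
  define m where "m = (\<integral>A. riem_dist X A \<partial>\<mu>)"
  define K where "K = (\<lambda>t. pd_log_at X (?b t))"
  have b: "posdef (?b t)" for t by (intro posdef_cartan_bary geo_push_P1)
  obtain \<epsilon> where \<epsilon>: "(\<epsilon> \<longlongrightarrow> 0) (at 0)" "\<And>t. t \<noteq> 0 \<Longrightarrow> norm (K t - t *\<^sub>R H) \<le> \<bar>t\<bar> * sqrt (\<epsilon> t)"
    using cartan_bary_geo_push_log_approx unfolding H_def K_def by blast
  have normK: "norm (K t) \<le> m * \<bar>t\<bar>" for t
    using cartan_bary_geo_push_lipschitz[of 0 t]
    by (simp add: K_def norm_pd_log_at X b cartan_bary_geo_push_zero m_def)
  interpret P: bounded_linear "congr ?P" by (rule bounded_linear_congr)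
  obtain c where c: "c \<ge> 0" "\<And>M. norm (congr ?P M) \<le> norm M * c"
    using P.nonneg_bounded by blast
  have X': "congr ?P (mat 1) = X" using X by (simp add: congr_def pd_pow_mult)
  have "(\<lambda>t. norm (?b (0 + t) - ?b 0 - t *\<^sub>R congr ?P H) / norm t) \<midarrow>0\<rightarrow> 0"
  proof (rule tendsto_sandwich)
    show "\<forall>\<^sub>F t in at 0. 0 \<le> norm (?b (0 + t) - ?b 0 - t *\<^sub>R congr ?P H) / norm t" by simp
    have "((\<lambda>t. m * \<bar>t\<bar>) \<longlongrightarrow> m * \<bar>0\<bar>) (at 0)" by (intro tendsto_intros)
    \<comment> \<open>Near 0 the chart value \<open>K t\<close> has norm at most 1, as the remainder
      estimate for \<open>mexp\<close> demands.\<close>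
    then have "\<forall>\<^sub>F t in at 0. m * \<bar>t\<bar> < 1" by (rule order_tendstoD) simp
    then show "\<forall>\<^sub>F t in at 0. norm (?b (0 + t) - ?b 0 - t *\<^sub>R congr ?P H) / norm t
        \<le> (m\<^sup>2 * \<bar>t\<bar> + sqrt (\<epsilon> t)) * c"
      using eventually_neq_at_within[of 0]
    proof eventually_elim
      case (elim t)
      have K1: "norm (K t) \<le> 1" using normK[of t] elim by simp
      have "?b (0 + t) - ?b 0 - t *\<^sub>R congr ?P H = congr ?P (mexp (K t) - mat 1 - t *\<^sub>R H)"
        using congr_mexp_pd_log_at[OF X b, of t]
        by (simp add: P.diff P.scaleR X' K_def cartan_bary_geo_push_zero)
      also have "norm \<dots> \<le> norm (mexp (K t) - mat 1 - t *\<^sub>R H) * c" by (rule c)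
      also have "\<dots> \<le> ((m * \<bar>t\<bar>)\<^sup>2 + \<bar>t\<bar> * sqrt (\<epsilon> t)) * c"
      proof (rule mult_right_mono[OF _ c(1)])
        have "norm (mexp (K t) - mat 1 - t *\<^sub>R H) \<le> norm (mexp (K t) - mat 1 - K t) + norm (K t - t *\<^sub>R H)"
          using norm_triangle_ineq[of "mexp (K t) - mat 1 - K t" "K t - t *\<^sub>R H"]
          by (simp only: add_diff_eq diff_add_cancel)
        also have "norm (mexp (K t) - mat 1 - K t) \<le> (norm (K t))\<^sup>2"
          using K1 by (intro norm_mexp_minus_one_minus_le) (simp_all add: K_def)
        also have "\<dots> \<le> (m * \<bar>t\<bar>)\<^sup>2" using normK by (intro power_mono) auto
        also have "norm (K t - t *\<^sub>R H) \<le> \<bar>t\<bar> * sqrt (\<epsilon> t)" using elim by (intro \<epsilon>)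
        finally show "norm (mexp (K t) - mat 1 - t *\<^sub>R H) \<le> (m * \<bar>t\<bar>)\<^sup>2 + \<bar>t\<bar> * sqrt (\<epsilon> t)" by simp
      qed
      also have "\<dots> = (m\<^sup>2 * \<bar>t\<bar> + sqrt (\<epsilon> t)) * c * \<bar>t\<bar>"
        by (simp add: power2_eq_square algebra_simps)
      finally show ?case using elim by (simp add: divide_le_eq)
    qed
    have "((\<lambda>t. (m\<^sup>2 * \<bar>t\<bar> + sqrt (\<epsilon> t)) * c) \<longlongrightarrow> (m\<^sup>2 * \<bar>0\<bar> + sqrt 0) * c) (at 0)"
      by (intro tendsto_intros \<epsilon>)
    then show "((\<lambda>t. (m\<^sup>2 * \<bar>t\<bar> + sqrt (\<epsilon> t)) * c) \<longlongrightarrow> 0) (at 0)" by simp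
  qed simp
  then show ?thesis
    by (simp add: has_vector_derivative_def has_derivative_at bounded_linear_scaleR_left H_def)
qed

end

theorem theorem1p2:
  fixes X :: "complex^'m^'m" and \<mu> :: "(complex^'m^'m) measure"
    and \<beta> :: "real \<Rightarrow> complex^'m^'m"
  assumes X: "posdef X"
    and mu: "\<mu> \<in> P1"
    and beta: "\<beta> = (\<lambda>t. cartan_bary (geo_push X t \<mu>))"
  shows "(\<forall>t. posdef (\<beta> t))
    \<and> (\<forall>t0. \<exists>e>0. \<exists>L. \<forall>s\<in>cball t0 e. \<forall>t\<in>cball t0 e.
           riem_dist (\<beta> s) (\<beta> t) \<le> L * \<bar>s - t\<bar>)
    \<and> (\<beta> has_vector_derivative
          (pd_pow (1/2) X ** (\<integral>A. pd_log (pd_pow (-1/2) X ** A ** pd_pow (-1/2) X) \<partial>\<mu>)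
             ** pd_pow (1/2) X)) (at 0)"
proof (intro conjI allI)
  show "posdef (\<beta> t)" for t
    unfolding beta by (intro posdef_cartan_bary geo_push_P1 X mu)
  \<comment> \<open>The Lipschitz bound is global, so radius 1 serves at every
    \<open>t0\<close>.\<close>
  show "\<exists>e>0. \<exists>L. \<forall>s\<in>cball t0 e. \<forall>t\<in>cball t0 e. riem_dist (\<beta> s) (\<beta> t) \<le> L * \<bar>s - t\<bar>" for t0
    unfolding beta using cartan_bary_geo_push_lipschitz[OF X mu] zero_less_one by blast
  have "pd_log_at X A = pd_log (pd_pow (-1/2) X ** A ** pd_pow (-1/2) X)" for A
    using X by (simp add: pd_log_at_def congr_def)
  then show "(\<beta> has_vector_derivative
          (pd_pow (1/2) X ** (\<integral>A. pd_log (pd_pow (-1/2) X ** A ** pd_pow (-1/2) X) \<partial>\<mu>)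
             ** pd_pow (1/2) X)) (at 0)"
    using cartan_bary_geo_push_has_vector_derivative[OF X mu] X by (simp add: beta congr_def)
qed

end
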